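(* Let $\nu$ be a Lévy measure on $(\mathbb{R}^T,\mathcal{B}^T)$, $b\in\mathbb{R}^T$, and let $V=(V_t)_{t\in T}$ be a representation of $\nu$ on a $\sigma$-finite measure space $(S,\mathcal{S},n)$. Let $n^{(1)}(ds)=g(s)\,n(ds)$ be a probability measure equivalent to $n$ (with $g>0$ $n$-a.e.), let $(\xi_j)_{j\in\mathbb{N}}$ be an i.i.d. sequence of random elements in $S$ with common distribution $n^{(1)}$, and let $(\Gamma_j)_{j\in\mathbb{N}}$ be a sequence of partial sums of i.i.d. mean-one exponential random variables independent of $(\xi_j)_{j\in\mathbb{N}}$. Consider the Poissonian infinitely divisible process $Y=(Y_t)_{t\in T}$ having Lévy measure $\nu$ and given by $$Y_t=\sum_{j=1}^\infty\Big[V_t(\xi_j)\mathbf{1}\{g(\xi_j)\le\Gamma_j^{-1}\}-c_j(t)\Big]+b(t),\qquad t\in T,$$ where $$c_j(t)=\int_SV_t(s)\,\chi(V_t(s))\,\big\{(jg(s)\wedge1)-((j-1)g(s)\wedge1)\big\}\,n(ds).$$ Let $\xi_0$ be a random element in $S$ independent of $(\xi_j,\Gamma_j)_{j\in\mathbb{N}}$ such that $\mathcal{L}(\xi_0)\ll\mathcal{L}(\xi_1)$, and let $q=\frac{d\mathcal{L}(\xi_0)}{dn}$. Then for any measurable functional $F:\mathbb{R}^T\to\mathbb{R}$ $$\mathbb{E}\big[F\big((V_t(\xi_0)+Y_t)_{t\in T}\big)\big]=\mathbb{E}\big[F\big((Y_t)_{t\in T}\big)\,Q\big],\qquad\text{where}\quad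 Q=\sum_{j=1}^\infty q(\xi_j)\mathbf{1}\{g(\xi_j)\le\Gamma_j^{-1}\}.$$ Conversely, $$\mathbb{E}\big[F\big((Y_t)_{t\in T}\big)\mathbf{1}_{\{Q>0\}}\big]=\mathbb{E}\int_SF\big((V_t(s)+Y_t)_{t\in T}\big)\,(Q+q(s))^{-1}\,q(s)\,n(ds).$$ Moreover, $Q>0$ a.s. provided $n\{s:q(s)>0\}=\infty$.
   Context: $T$ is an arbitrary nonempty set, $\mathbb{R}^T$ the space of all functions $x:T\to\mathbb{R}$, $\mathcal{B}^T$ its cylindrical (product) $\sigma$-algebra, $x_I$ the restriction of $x$ to $I\subset T$, $0_I$ the origin of $\mathbb{R}^I$, $\pi_I(x)=x_I$, $\mathcal{B}_0^I=\{B\in\mathcal{B}^I:0_I\notin B\}$. $\mathcal{L}(\cdot)$ is the law of a random element. Convention $0\cdot\infty=0$. Identities between expectations read: if one side exists then the other does and they are equal. A measure $\nu$ on $(\mathbb{R}^T,\mathcal{B}^T)$ is a Lévy measure if (L1) $\int|x(t)|^2\wedge1\,\nu(dx)<\infty$ for every $t\in T$, and (L2) $\nu(A)=\nu_*(A\setminus\{0_T\})$ for every $A\in\mathcal{B}^T$, where $\nu_*(E)=\sup\{\nu(D):D\subset E,\ D\in\mathcal{B}^T\}$. A representation of $\nu$ is a collection $V=(V_t)_{t\in T}$ of measurable real functions on a measure space $(S,\mathcal{S},n)$ such that $n\{s:V_I(s)\in B\}=\nu(\pi_I^{-1}(B))$ for every finite nonempty $I\subset T$ and $B\in\mathcal{B}_0^I$,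 where $V_I=(V_t)_{t\in I}$. $\chi$ is a fixed cutoff function: bounded measurable $\chi:\mathbb{R}\to\mathbb{R}$ with $\chi(v)=1+o(|v|)$ as $v\to0$ and $\chi(v)=O(|v|^{-1})$ as $|v|\to\infty$. The series defining $Y_t$ converges a.s. for every $t\in T$, and $Y$ is the Poissonian infinitely divisible process with Lévy measure $\nu$ and shift $b$, i.e. for all finite nonempty $I\subset T$, $a\in\mathbb{R}^I$: $\mathbb{E}e^{i\sum_{t\in I}a_tY_t}=\exp\{\int_{\mathbb{R}^T}(e^{i\sum_{t\in I}a_tx(t)}-1-i\sum_{t\in I}a_tx(t)\chi(x(t)))\,\nu(dx)+i\sum_{t\in I}a_tb(t)\}$. *)

theory Defs
  imports "HOL-Probability.Probability"
begin

text \<open>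
  The index set \<open>T\<close> is the universe of an arbitrary type \<open>'t\<close>, so paths \<open>x : T \<rightarrow> \<real>\<close> are functions of
  type \<open>'t \<Rightarrow> real\<close>, and \<open>path_space\<close> carries the cylindrical sigma-algebra.
\<close>

abbreviation path_space :: "('t \<Rightarrow> real) measure" where
  "path_space \<equiv> Pi\<^sub>M UNIV (\<lambda>_. borel)"

definition inner_measure :: "'a measure \<Rightarrow> 'a set \<Rightarrow> ennreal" where
  "inner_measure M E = (SUP D \<in> {D \<in> sets M. D \<subseteq> E}. emeasure M D)"

definition levy_measure :: "('t \<Rightarrow> real) measure \<Rightarrow> bool" where
  "levy_measure \<nu> \<longleftrightarrow>
     sets \<nu> = sets path_space \<and>
     (\<forall>t. (\<integral>\<^sup>+ x. ennreal (min (\<bar>x t\<bar>\<^sup>2) 1) \<partial>\<nu>) < \<infinity>) \<and>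
     (\<forall>A \<in> sets path_space. emeasure \<nu> A = inner_measure \<nu> (A - {\<lambda>_. 0}))"

text \<open>The space \<open>\<real>\<^sup>I\<close> is \<open>Pi\<^sub>M I (\<lambda>_. borel)\<close>, whose points are the functions that are
  \<^const>\<open>undefined\<close> off \<open>I\<close>; in particular its origin is \<open>restrict (\<lambda>_. 0) I\<close>.\<close>

definition levy_representation ::
    "('t \<Rightarrow> real) measure \<Rightarrow> 's measure \<Rightarrow> ('t \<Rightarrow> 's \<Rightarrow> real) \<Rightarrow> bool" where
  "levy_representation \<nu> n V \<longleftrightarrow>
     (\<forall>t. V t \<in> borel_measurable n) \<and>
     (\<forall>I B. finite I \<and> I \<noteq> {} \<and> B \<in> sets (Pi\<^sub>M I (\<lambda>_. borel)) \<and> restrict (\<lambda>_. 0) I \<notin> B \<longrightarrow>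
        emeasure n {s \<in> space n. restrict (\<lambda>t. V t s) I \<in> B} =
        emeasure \<nu> {x \<in> space \<nu>. restrict x I \<in> B})"

text \<open>The cutoff function \<open>\<chi>\<close> is called \<open>\<kappa>\<close>, since \<open>\<chi>\<close> is the vector binder of the library.\<close>

definition cutoff_function :: "(real \<Rightarrow> real) \<Rightarrow> bool" where
  "cutoff_function \<kappa> \<longleftrightarrow>
     \<kappa> \<in> borel_measurable borel \<and> bounded (range \<kappa>) \<and>
     (\<lambda>v. \<kappa> v - 1) \<in> o[at 0](\<lambda>v. \<bar>v\<bar>) \<and>
     \<kappa> \<in> O[at_infinity](\<lambda>v. inverse \<bar>v\<bar>)"

context prob_space
begin

definition poissonian_id_process ::
    "('t \<Rightarrow> real) measure \<Rightarrow> (real \<Rightarrow> real) \<Rightarrow> ('t \<Rightarrow> real) \<Rightarrow> ('t \<Rightarrow> 'a \<Rightarrow> real) \<Rightarrow> bool" where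
  "poissonian_id_process \<nu> \<kappa> b Y \<longleftrightarrow>
     (\<forall>t. Y t \<in> borel_measurable M) \<and>
     (\<forall>I a. finite I \<and> I \<noteq> {} \<longrightarrow>
        (\<integral>\<omega>. iexp (\<Sum>t\<in>I. a t * Y t \<omega>) \<partial>M) =
        exp ((\<integral>x. iexp (\<Sum>t\<in>I. a t * x t) - 1
                   - \<i> * complex_of_real (\<Sum>t\<in>I. a t * x t * \<kappa> (x t)) \<partial>\<nu>)
             + \<i> * complex_of_real (\<Sum>t\<in>I. a t * b t)))"

definition iid_sequence :: "'b measure \<Rightarrow> (nat \<Rightarrow> 'a \<Rightarrow> 'b) \<Rightarrow> 'b measure \<Rightarrow> bool" where
  "iid_sequence N X D \<longleftrightarrow> indep_vars (\<lambda>_. N) X UNIV \<and> (\<forall>j. distr M N (X j) = D)"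

text \<open>\<^const>\<open>indep_var\<close> requires both random elements to have values in the same type.\<close>

definition indep_elements :: "'b measure \<Rightarrow> ('a \<Rightarrow> 'b) \<Rightarrow> 'c measure \<Rightarrow> ('a \<Rightarrow> 'c) \<Rightarrow> bool" where
  "indep_elements N X N' X' \<longleftrightarrow>
     X \<in> M \<rightarrow>\<^sub>M N \<and> X' \<in> M \<rightarrow>\<^sub>M N' \<and>
     indep_set {X -` A \<inter> space M | A. A \<in> sets N} {X' -` A \<inter> space M | A. A \<in> sets N'}"

text \<open>Sequences are indexed from 0, so \<open>\<Gamma> j\<close> is the sum of the first \<open>j + 1\<close> variables.\<close>

definition exponential_partial_sums :: "(nat \<Rightarrow> 'a \<Rightarrow> real) \<Rightarrow> bool" where
  "exponential_partial_sums \<Gamma> \<longleftrightarrow>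
     (\<exists>E. iid_sequence borel E (density lborel (\<lambda>x. ennreal (exponential_density 1 x))) \<and>
          (\<forall>j. \<forall>\<omega>\<in>space M. \<Gamma> j \<omega> = (\<Sum>k\<le>j. E k \<omega>)))"

end

text \<open>
  An integral of an extended real function exists if its positive or its negative part has
  finite integral; its value is then a possibly infinite number.  Thus
  \<open>\<forall>e. has_ext_integral M f e \<longleftrightarrow> has_ext_integral M' f' e\<close> says that if one of the two integrals
  exists then so does the other and they are equal. For real-valued \<open>f\<close> and finite \<open>e\<close> this is Bochner
  integrability with integral \<open>e\<close>.
\<close>

definition ext_integral :: "'a measure \<Rightarrow> ('a \<Rightarrow> ereal) \<Rightarrow> ereal" where
  "ext_integral M f =
     enn2ereal (\<integral>\<^sup>+ x. e2ennreal (f x) \<partial>M) - enn2ereal (\<integral>\<^sup>+ x. e2ennreal (- f x) \<partial>M)"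

definition ext_integral_exists :: "'a measure \<Rightarrow> ('a \<Rightarrow> ereal) \<Rightarrow> bool" where
  "ext_integral_exists M f \<longleftrightarrow>
     f \<in> borel_measurable M \<and>
     ((\<integral>\<^sup>+ x. e2ennreal (f x) \<partial>M) < \<infinity> \<or> (\<integral>\<^sup>+ x. e2ennreal (- f x) \<partial>M) < \<infinity>)"

definition has_ext_integral :: "'a measure \<Rightarrow> ('a \<Rightarrow> ereal) \<Rightarrow> ereal \<Rightarrow> bool" where
  "has_ext_integral M f e \<longleftrightarrow> ext_integral_exists M f \<and> ext_integral M f = e"

text \<open>
  Existence of an iterated integral refers to the product measure: by Fubini's theorem the inner
  integral then exists almost everywhere.  Mere existence of the iterated integral would allow
  cancellation in the inner integral of a function that is not integrable on the product.
\<close>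

definition has_iterated_ext_integral ::
    "'a measure \<Rightarrow> 'b measure \<Rightarrow> ('a \<Rightarrow> 'b \<Rightarrow> ereal) \<Rightarrow> ereal \<Rightarrow> bool" where
  "has_iterated_ext_integral M N f e \<longleftrightarrow>
     ext_integral_exists (M \<Otimes>\<^sub>M N) (\<lambda>(x, y). f x y) \<and>
     (AE x in M. ext_integral_exists N (f x)) \<and>
     has_ext_integral M (\<lambda>x. ext_integral N (f x)) e"

end

theory Submission
  imports Defs
begin

text \<open>
  The points \<open>\<xi> j\<close> with \<open>g (\<xi> j) \<le> 1 / \<Gamma> j\<close> form a Poisson point process with intensity \<open>n\<close>; up to the
  shift \<open>b\<close>, the variable \<open>Y t\<close> is the compensated sum of \<open>V t\<close> over these points, and \<open>Q\<close> is the sum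
  of \<open>q\<close> over them. Adding a point at \<open>s\<close> turns \<open>Y\<close> into \<open>V s + Y\<close> and \<open>Q\<close> into \<open>Q + q s\<close>. Hence Mecke's
  formula for the Poisson process says
  \<open>E [F(Y) \<phi>(Q) Q] = E \<integral> F(V s + Y) \<phi>(Q + q s) q s n(ds)\<close>
  for nonnegative \<open>F\<close> and \<open>\<phi>\<close> (lemma \<open>Mecke_functional\<close>), and everything is read off from it. With
  \<open>\<phi> = 1\<close>, integrating against \<open>q dn\<close> is sampling the independent \<open>\<xi>0\<close>, which is the first identity.
  With \<open>\<phi> u = 1 / u\<close> the left-hand side is the expectation of \<open>F(Y)\<close> on \<open>Q > 0\<close>, because \<open>Q\<close> has mean
  one and is therefore finite; this is the second identity. For the last claim, let \<open>N\<close> be the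
  number of points in \<open>{q > 0}\<close>. The same formula for the indicator of this set and
  \<open>\<phi> = 1\<^bsub>{1}\<^esub>\<close> says that the probability of \<open>N = 1\<close> is \<open>n {q > 0}\<close> times that of \<open>N = 0\<close>. If the
  first factor is infinite, the second one vanishes.

  Mecke's formula is proved on the sequences themselves, by omitting one entry. Omitting the
  \<open>j\<close>-th of independent identically distributed marks leaves a sequence of the same law that is
  independent of the omitted mark. For the arrival times, if \<open>U\<close> and \<open>V\<close> are independent standard
  exponential variables, then \<open>(U, U + V)\<close> is distributed as a standard exponential \<open>W\<close> together
  with Lebesgue measure on \<open>(0, W)\<close>. So omitting \<open>\<Gamma> j\<close> leaves a sequence with the law of \<open>\<Gamma>\<close>, and the
  omitted time is spread by Lebesgue measure over the \<open>j\<close>-th gap of that sequence. Summed over \<open>j\<close> the gaps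
  tile the half-line, and the condition \<open>r \<le> 1 / g s\<close> turns Lebesgue measure in \<open>r\<close> and the law
  \<open>g dn\<close> of the marks into \<open>n\<close> (lemmas \<open>nn_integral_arrival_omit\<close> and \<open>Mecke_active\<close>).

  Two points need care. The compensators \<open>c j\<close> belong to the indices and not to the points, so they
  are shifted when an entry is omitted; as \<open>c j\<close> tends to zero, the sum is not affected. And the
  series for \<open>Y t\<close> converges to it almost surely for each \<open>t\<close>, with an exceptional set that depends on
  \<open>t\<close>, while the index set may be uncountable; this does no harm, as a measurable functional of a
  path depends on countably many coordinates only.
\<close>

section \<open>Measurable functionals of paths\<close>

text \<open>
  The sets with this property form a \<open>\<sigma>\<close>-algebra that contains the cylinders
  over one coordinate.
\<close>

lemma sets_PiM_countably_determined:
  assumes "A \<in> sets (Pi\<^sub>M UNIV N)"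
  shows "\<exists>J. countable J \<and> (\<forall>x\<in>space (Pi\<^sub>M UNIV N). \<forall>y\<in>space (Pi\<^sub>M UNIV N).
    (\<forall>t\<in>J. x t = y t) \<longrightarrow> (x \<in> A \<longleftrightarrow> y \<in> A))"
proof -
  let ?S = "space (Pi\<^sub>M UNIV N)"
  let ?P = "\<lambda>A. \<exists>J. countable J \<and> (\<forall>x\<in>?S. \<forall>y\<in>?S. (\<forall>t\<in>J. x t = y t) \<longrightarrow> (x \<in> A \<longleftrightarrow> y \<in> A))"
  have "A \<in> sigma_sets (\<Pi>\<^sub>E i\<in>UNIV. space (N i))
      {{f \<in> \<Pi>\<^sub>E i\<in>UNIV. space (N i). f i \<in> B} | i B. i \<in> UNIV \<and> B \<in> sets (N i)}"
    using assms unfolding sets_PiM_single .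
  then show ?thesis
  proof (induction rule: sigma_sets.induct)
    case (Basic a)
    then obtain i B where "a = {f \<in> \<Pi>\<^sub>E i\<in>UNIV. space (N i). f i \<in> B}"
      by auto
    then show ?case
      by (intro exI[of _ "{i}"]) (auto simp: space_PiM)
  next
    case Empty
    show ?case
      by (intro exI[of _ "{}"]) auto
  next
    case (Compl a)
    from Compl.IH obtain J where J: "countable J \<and>
        (\<forall>x\<in>?S. \<forall>y\<in>?S. (\<forall>t\<in>J. x t = y t) \<longrightarrow> (x \<in> a \<longleftrightarrow> y \<in> a))" ..
    show ?case
    proof (intro exI[of _ J] conjI ballI impI)
      fix x y assume "x \<in> ?S" "y \<in> ?S" "\<forall>t\<in>J. x t = y t"
      then show "x \<in> (\<Pi>\<^sub>E i\<in>UNIV. space (N i)) - a \<longleftrightarrow> y \<in> (\<Pi>\<^sub>E i\<in>UNIV. space (N i)) - a"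
        using J[THEN conjunct2, rule_format, of x y] by (simp add: space_PiM)
    qed (rule J[THEN conjunct1])
  next
    case (Union a)
    have "\<forall>i. \<exists>J. countable J \<and> (\<forall>x\<in>?S. \<forall>y\<in>?S. (\<forall>t\<in>J. x t = y t) \<longrightarrow> (x \<in> a i \<longleftrightarrow> y \<in> a i))"
      by (rule allI) (rule Union.IH)
    from choice[OF this] obtain J where J: "\<forall>i. countable (J i) \<and>
        (\<forall>x\<in>?S. \<forall>y\<in>?S. (\<forall>t\<in>J i. x t = y t) \<longrightarrow> (x \<in> a i \<longleftrightarrow> y \<in> a i))" ..
    have "\<forall>x\<in>?S. \<forall>y\<in>?S. (\<forall>t\<in>\<Union>i. J i. x t = y t) \<longrightarrow> (x \<in> (\<Union>i. a i) \<longleftrightarrow> y \<in> (\<Union>i. a i))"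
    proof (intro ballI impI)
      fix x y assume xy: "x \<in> ?S" "y \<in> ?S" and eq: "\<forall>t\<in>\<Union>i. J i. x t = y t"
      have "x \<in> a i \<longleftrightarrow> y \<in> a i" for i
      proof (rule J[THEN spec, of i, THEN conjunct2, rule_format, OF xy])
        show "x t = y t" if "t \<in> J i" for t
          using that eq by blast
      qed
      then show "x \<in> (\<Union>i. a i) \<longleftrightarrow> y \<in> (\<Union>i. a i)"
        by simp
    qed
    moreover have "countable (\<Union>i. J i)"
      by (rule countable_UN[OF countableI_type]) (rule J[THEN spec, THEN conjunct1])
    ultimately show ?case
      by (intro exI[of _ "\<Union>i. J i"] conjI)
  qed
qed

text \<open>
  Collect the coordinates of the preimages of the sets of a countable basis: these sets separate
  the values of \<open>F\<close>.
\<close>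

lemma path_functional_countably_determined:
  fixes F :: "('t \<Rightarrow> real) \<Rightarrow> 'b :: {second_countable_topology, t1_space}"
  assumes F: "F \<in> borel_measurable path_space"
  shows "\<exists>J. countable J \<and> (\<forall>x y. (\<forall>t\<in>J. x t = y t) \<longrightarrow> F x = F y)"
proof -
  obtain \<B> :: "'b set set" where \<B>: "countable \<B>" "topological_basis \<B>"
    using ex_countable_basis by auto
  have "\<forall>U\<in>\<B>. \<exists>J. countable J \<and> (\<forall>x y. (\<forall>t\<in>J. x t = y t) \<longrightarrow> (F x \<in> U \<longleftrightarrow> F y \<in> U))"
  proof
    fix U assume "U \<in> \<B>"
    then have "F -` U \<inter> space path_space \<in> sets path_space"
      using F \<B>(2) by (intro measurable_sets[OF F]) (simp add: topological_basis_open)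
    from sets_PiM_countably_determined[OF this]
    show "\<exists>J. countable J \<and> (\<forall>x y. (\<forall>t\<in>J. x t = y t) \<longrightarrow> (F x \<in> U \<longleftrightarrow> F y \<in> U))"
      by (simp add: space_PiM)
  qed
  then obtain J where J: "\<And>U. U \<in> \<B> \<Longrightarrow> countable (J U)"
    "\<And>U x y. U \<in> \<B> \<Longrightarrow> \<forall>t\<in>J U. x t = y t \<Longrightarrow> F x \<in> U \<longleftrightarrow> F y \<in> U"
    by metis
  have "F x = F y" if "\<forall>t\<in>\<Union>(J ` \<B>). x t = y t" for x y
  proof (rule ccontr)
    assume "F x \<noteq> F y"
    then obtain W where "open W" "F x \<in> W" "F y \<notin> W"
      using t1_space by blast
    then obtain U where "U \<in> \<B>" "F x \<in> U" "F y \<notin> U"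
      using topological_basisE[OF \<B>(2)] by (metis subsetD)
    with J(2)[of U x y] that show False
      by blast
  qed
  moreover have "countable (\<Union>(J ` \<B>))"
    using J(1) \<B>(1) by auto
  ultimately show ?thesis
    by blast
qed

text \<open>
  This replaces a process by a version of it, although the exceptional set depends on
  \<open>t\<close> and there may be uncountably many \<open>t\<close>.
\<close>

lemma AE_path_functional_eq:
  fixes F :: "('t \<Rightarrow> real) \<Rightarrow> 'b :: {second_countable_topology, t1_space}"
  assumes "F \<in> borel_measurable path_space" and "\<And>t. AE \<omega> in M. X \<omega> t = X' \<omega> t"
  shows "AE \<omega> in M. F (X \<omega>) = F (X' \<omega>)"
proof -
  obtain J where J: "countable J" "\<And>x y. (\<forall>t\<in>J. x t = y t) \<Longrightarrow> F x = F y"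
    using path_functional_countably_determined[OF assms(1)] by blast
  have "AE \<omega> in M. \<forall>t\<in>J. X \<omega> t = X' \<omega> t"
    using assms(2) by (simp add: AE_ball_countable[OF J(1)])
  then show ?thesis
    by eventually_elim (rule J(2))
qed

lemma measurable_path_functional:
  assumes F: "F \<in> path_space \<rightarrow>\<^sub>M K" and f: "\<And>t. (\<lambda>x. f x t) \<in> borel_measurable N"
  shows "(\<lambda>x. F (f x)) \<in> N \<rightarrow>\<^sub>M K"
proof (rule measurable_compose[OF _ F])
  show "f \<in> N \<rightarrow>\<^sub>M path_space"
    by (rule measurable_PiM_single') (auto simp: space_PiM f)
qed

section \<open>Integrals with extended real values\<close>

lemma e2ennreal_ereal_times_enn2ereal:
  "e2ennreal (ereal x * enn2ereal u) = ennreal x * u"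
  "e2ennreal (- (ereal x * enn2ereal u)) = ennreal (- x) * u"
proof -
  have *: "e2ennreal (ereal x * enn2ereal u) = ennreal x * u" for x
  proof (cases "0 \<le> x")
    case True
    then have "ereal x * enn2ereal u = enn2ereal (ennreal x * u)"
      by (simp add: times_ennreal.rep_eq enn2ereal_ennreal)
    then show ?thesis
      by simp
  next
    case False
    then have "x \<le> 0"
      by simp
    then have "ereal x * enn2ereal u \<le> 0"
      by (metis enn2ereal_nonneg ereal_less_eq(4) ereal_mult_right_mono ereal_zero_times)
    with False show ?thesis
      by (simp add: e2ennreal_neg ennreal_neg)
  qed
  show "e2ennreal (ereal x * enn2ereal u) = ennreal x * u"
    by (rule *)
  show "e2ennreal (- (ereal x * enn2ereal u)) = ennreal (- x) * u"
    using *[of "- x"] by (simp flip: uminus_ereal.simps)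
qed

lemma has_ext_integral_iff_eq_parts:
  assumes "f \<in> borel_measurable M" "f' \<in> borel_measurable M'"
    and "(\<integral>\<^sup>+x. e2ennreal (f x) \<partial>M) = (\<integral>\<^sup>+x. e2ennreal (f' x) \<partial>M')"
    and "(\<integral>\<^sup>+x. e2ennreal (- f x) \<partial>M) = (\<integral>\<^sup>+x. e2ennreal (- f' x) \<partial>M')"
  shows "has_ext_integral M f e \<longleftrightarrow> has_ext_integral M' f' e"
  using assms by (simp add: has_ext_integral_def ext_integral_exists_def ext_integral_def)

lemma enn2ereal_diff_eqI:
  fixes p m p' m' :: ennreal
  assumes "p \<noteq> \<top>" "p' \<noteq> \<top>" "p + m' = m + p'"
  shows "enn2ereal p' - enn2ereal m' = enn2ereal p - enn2ereal m"
proof (cases "m = \<top>")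
  case True
  then have "p + m' = \<top>"
    using assms by simp
  then have "m' = \<top>"
    using assms by simp
  with True assms show ?thesis
    by (cases p; cases p') (auto simp: enn2ereal_ennreal)
next
  case False
  then have "m + p' \<noteq> \<top>"
    using assms by simp
  then have "m' \<noteq> \<top>"
    using assms(3) by (metis add_top_right_ennreal)
  with assms False show ?thesis
    by (cases p; cases p'; cases m; cases m') (auto simp: enn2ereal_ennreal simp flip: ennreal_plus)
qed

lemma ue2eenreal_enn2ereal_diff_diff:
  "p \<noteq> \<top> \<or> m \<noteq> \<top> \<Longrightarrow> - (enn2ereal p - enn2ereal m) = enn2ereal m - enn2ereal p"
  by (cases p; cases m) (auto simp: enn2ereal_ennreal)

text \<open>
  Where \<open>p\<close> is finite, both sides are the integral of the pointwise maximum of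
  \<open>p\<close> and \<open>m\<close>. Truncated subtraction yields the positive and the
  negative part of the extended real difference of \<open>p\<close> and \<open>m\<close>.
\<close>

lemma nn_integral_diff_balance:
  fixes p m :: "'a \<Rightarrow> ennreal"
  assumes [measurable]: "p \<in> borel_measurable M" "m \<in> borel_measurable M"
    and fin: "AE x in M. p x \<noteq> \<top>"
  shows "(\<integral>\<^sup>+x. p x \<partial>M) + (\<integral>\<^sup>+x. m x - p x \<partial>M) = (\<integral>\<^sup>+x. m x \<partial>M) + (\<integral>\<^sup>+x. p x - m x \<partial>M)"
proof -
  have "p x + (m x - p x) = m x + (p x - m x)" if "p x \<noteq> \<top>" for x
    using that by (cases "p x \<le> m x") (simp_all add: diff_eq_0_ennreal add_diff_inverse_ennreal less_top)
  with fin have "(\<integral>\<^sup>+x. p x + (m x - p x) \<partial>M) = (\<integral>\<^sup>+x. m x + (p x - m x) \<partial>M)"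
    by (intro nn_integral_cong_AE) auto
  then show ?thesis
    by (simp add: nn_integral_add)
qed

lemma AE_finite_of_nn_integral_finite:
  fixes p m :: "'a \<Rightarrow> ennreal"
  assumes "p \<in> borel_measurable M" "m \<in> borel_measurable M"
    and "(\<integral>\<^sup>+x. p x \<partial>M) < \<infinity> \<or> (\<integral>\<^sup>+x. m x \<partial>M) < \<infinity>"
  shows "AE x in M. p x \<noteq> \<top> \<or> m x \<noteq> \<top>"
  using assms(3)
proof
  assume "(\<integral>\<^sup>+x. p x \<partial>M) < \<infinity>"
  then have "AE x in M. p x \<noteq> \<infinity>"
    by (intro nn_integral_noteq_infinite assms(1)) auto
  then show ?thesis
    by eventually_elim simp
next
  assume "(\<integral>\<^sup>+x. m x \<partial>M) < \<infinity>"
  then have "AE x in M. m x \<noteq> \<infinity>"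
    by (intro nn_integral_noteq_infinite assms(2)) auto
  then show ?thesis
    by eventually_elim simp
qed

text \<open>
  Linearity in the only case that makes sense for extended integrals; \<open>p\<close> and
  \<open>m\<close> may overlap, so they need not be the positive and negative part of their
  difference.
\<close>

lemma has_ext_integral_diff:
  assumes p [measurable]: "p \<in> borel_measurable M" and m [measurable]: "m \<in> borel_measurable M"
    and fin: "(\<integral>\<^sup>+x. p x \<partial>M) < \<infinity> \<or> (\<integral>\<^sup>+x. m x \<partial>M) < \<infinity>"
  shows "has_ext_integral M (\<lambda>x. enn2ereal (p x) - enn2ereal (m x))
    (enn2ereal (\<integral>\<^sup>+x. p x \<partial>M) - enn2ereal (\<integral>\<^sup>+x. m x \<partial>M))"
proof -
  from AE_finite_of_nn_integral_finite[OF p m fin] have "AE x in M. - (enn2ereal (p x) - enn2ereal (m x)) = enn2ereal (m x) - enn2ereal (p x)"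
    by eventually_elim (simp add: ue2eenreal_enn2ereal_diff_diff)
  then have "(\<integral>\<^sup>+x. e2ennreal (- (enn2ereal (p x) - enn2ereal (m x))) \<partial>M) = (\<integral>\<^sup>+x. m x - p x \<partial>M)"
    by (intro nn_integral_cong_AE) (auto elim!: eventually_mono simp: e2eenreal_enn2ereal_diff)
  note parts = e2eenreal_enn2ereal_diff this
  have le: "(\<integral>\<^sup>+x. p x - m x \<partial>M) \<le> (\<integral>\<^sup>+x. p x \<partial>M)" "(\<integral>\<^sup>+x. m x - p x \<partial>M) \<le> (\<integral>\<^sup>+x. m x \<partial>M)"
    by (intro nn_integral_mono diff_le_self_ennreal)+
  have eq: "enn2ereal (\<integral>\<^sup>+x. p x - m x \<partial>M) - enn2ereal (\<integral>\<^sup>+x. m x - p x \<partial>M) =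
      enn2ereal (\<integral>\<^sup>+x. p x \<partial>M) - enn2ereal (\<integral>\<^sup>+x. m x \<partial>M)"
    using fin
  proof
    assume *: "(\<integral>\<^sup>+x. p x \<partial>M) < \<infinity>"
    then have "AE x in M. p x \<noteq> \<top>"
      using nn_integral_noteq_infinite[OF p] by auto
    from nn_integral_diff_balance[OF p m this] * le show ?thesis
      by (intro enn2ereal_diff_eqI) auto
  next
    assume *: "(\<integral>\<^sup>+x. m x \<partial>M) < \<infinity>"
    then have "AE x in M. m x \<noteq> \<top>"
      using nn_integral_noteq_infinite[OF m] by auto
    from nn_integral_diff_balance[OF m p this] * le
    have "enn2ereal (\<integral>\<^sup>+x. m x - p x \<partial>M) - enn2ereal (\<integral>\<^sup>+x. p x - m x \<partial>M) =
        enn2ereal (\<integral>\<^sup>+x. m x \<partial>M) - enn2ereal (\<integral>\<^sup>+x. p x \<partial>M)"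
      by (intro enn2ereal_diff_eqI) auto
    then have "- (enn2ereal (\<integral>\<^sup>+x. m x - p x \<partial>M) - enn2ereal (\<integral>\<^sup>+x. p x - m x \<partial>M)) =
        - (enn2ereal (\<integral>\<^sup>+x. m x \<partial>M) - enn2ereal (\<integral>\<^sup>+x. p x \<partial>M))"
      by simp
    then show ?thesis
      using * le by (subst (asm) (1 2) ue2eenreal_enn2ereal_diff_diff) (auto simp: top_unique)
  qed
  show ?thesis
    unfolding has_ext_integral_def ext_integral_exists_def ext_integral_def parts
    using fin le eq by (auto intro: le_less_trans)
qed

text \<open>
  Fubini's theorem for extended integrals: the inner integral is the difference of the inner
  integrals of the two parts, and these have the integrals of the parts over the product by
  Tonelli's theorem.
\<close>

lemma (in pair_sigma_finite) has_iterated_ext_integral_iff: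
  assumes f: "(\<lambda>(x, y). f x y) \<in> borel_measurable (M1 \<Otimes>\<^sub>M M2)"
  shows "has_iterated_ext_integral M1 M2 f e \<longleftrightarrow> has_ext_integral (M1 \<Otimes>\<^sub>M M2) (\<lambda>(x, y). f x y) e"
proof (cases "ext_integral_exists (M1 \<Otimes>\<^sub>M M2) (\<lambda>(x, y). f x y)")
  case False
  then show ?thesis
    by (simp add: has_iterated_ext_integral_def has_ext_integral_def)
next
  case True
  define p where "p x = (\<integral>\<^sup>+y. e2ennreal (f x y) \<partial>M2)" for x
  define m where "m x = (\<integral>\<^sup>+y. e2ennreal (- f x y) \<partial>M2)" for x
  note [measurable] = f
  have p [measurable]: "p \<in> borel_measurable M1" and m [measurable]: "m \<in> borel_measurable M1"
    unfolding p_def m_def by measurable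
  have P: "(\<integral>\<^sup>+z. e2ennreal (case z of (x, y) \<Rightarrow> f x y) \<partial>(M1 \<Otimes>\<^sub>M M2)) = (\<integral>\<^sup>+x. p x \<partial>M1)"
    and M: "(\<integral>\<^sup>+z. e2ennreal (- (case z of (x, y) \<Rightarrow> f x y)) \<partial>(M1 \<Otimes>\<^sub>M M2)) = (\<integral>\<^sup>+x. m x \<partial>M1)"
    unfolding p_def m_def by (simp_all flip: M2.nn_integral_fst)
  have fin: "(\<integral>\<^sup>+x. p x \<partial>M1) < \<infinity> \<or> (\<integral>\<^sup>+x. m x \<partial>M1) < \<infinity>"
    using True unfolding ext_integral_exists_def P M by simp
  have inner: "ext_integral M2 (f x) = enn2ereal (p x) - enn2ereal (m x)" for x
    by (simp add: ext_integral_def p_def m_def)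
  have "AE x in M1. ext_integral_exists M2 (f x)"
    using AE_finite_of_nn_integral_finite[OF p m fin] AE_space
  proof eventually_elim
    case (elim x)
    then have "f x \<in> borel_measurable M2"
      using measurable_Pair2[OF f, of x] by simp
    with elim show ?case
      by (auto simp: ext_integral_exists_def p_def m_def less_top)
  qed
  moreover have "has_ext_integral M1 (\<lambda>x. ext_integral M2 (f x)) (ext_integral (M1 \<Otimes>\<^sub>M M2) (\<lambda>(x, y). f x y))"
  proof -
    have "ext_integral (M1 \<Otimes>\<^sub>M M2) (\<lambda>(x, y). f x y) =
        enn2ereal (\<integral>\<^sup>+x. p x \<partial>M1) - enn2ereal (\<integral>\<^sup>+x. m x \<partial>M1)"
      by (simp only: ext_integral_def P M)
    then show ?thesis
      using has_ext_integral_diff[OF p m fin] by (simp only: inner)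
  qed
  ultimately show ?thesis
    using True by (auto simp: has_iterated_ext_integral_def has_ext_integral_def)
qed

section \<open>Omitting an entry of a sequence\<close>

lemma measurable_coordinate: "(\<lambda>x. x i) \<in> Pi\<^sub>M UNIV (\<lambda>_. N) \<rightarrow>\<^sub>M N"
  by (rule measurable_component_singleton) simp

definition omit :: "nat \<Rightarrow> (nat \<Rightarrow> 'a) \<Rightarrow> nat \<Rightarrow> 'a" where
  "omit j x i = x (if i < j then i else Suc i)"

lemma measurable_omit [measurable]: "omit j \<in> Pi\<^sub>M UNIV (\<lambda>_. N) \<rightarrow>\<^sub>M Pi\<^sub>M UNIV (\<lambda>_. N)"
proof -
  have "(\<lambda>x i. x (if i < j then i else Suc i)) \<in> Pi\<^sub>M UNIV (\<lambda>_. N) \<rightarrow>\<^sub>M Pi\<^sub>M UNIV (\<lambda>_. N)"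
    by (rule measurable_PiM_single') (auto simp: space_PiM)
  then show ?thesis
    unfolding omit_def[abs_def] .
qed

lemma sequence_space_prob_space: "prob_space N \<Longrightarrow> sequence_space N"
  by (simp add: sequence_space_def product_prob_spaceI)

lemma nn_integral_PiM_case_nat:
  assumes N: "prob_space N" and [measurable]: "h \<in> borel_measurable (Pi\<^sub>M UNIV (\<lambda>_::nat. N))"
  shows "(\<integral>\<^sup>+x. h x \<partial>Pi\<^sub>M UNIV (\<lambda>_. N)) =
    (\<integral>\<^sup>+s. \<integral>\<^sup>+y. h (case_nat s y) \<partial>Pi\<^sub>M UNIV (\<lambda>_. N) \<partial>N)"
proof -
  interpret sequence_space N by (rule sequence_space_prob_space[OF N])
  have "(\<integral>\<^sup>+x. h x \<partial>S) = (\<integral>\<^sup>+x. h x \<partial>distr (N \<Otimes>\<^sub>M S) S (\<lambda>(s, \<omega>). case_nat s \<omega>))"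
    by (simp only: PiM_iter)
  also have "\<dots> = (\<integral>\<^sup>+z. h (case z of (s, \<omega>) \<Rightarrow> case_nat s \<omega>) \<partial>(N \<Otimes>\<^sub>M S))"
    by (rule nn_integral_distr) simp_all
  also have "\<dots> = (\<integral>\<^sup>+s. \<integral>\<^sup>+y. h (case_nat s y) \<partial>S \<partial>N)"
    by (subst P.nn_integral_fst[symmetric]) simp_all
  finally show ?thesis .
qed

lemma nn_integral_PiM_comb_seq:
  assumes N: "prob_space N" and [measurable]: "h \<in> borel_measurable (Pi\<^sub>M UNIV (\<lambda>_::nat. N))"
  shows "(\<integral>\<^sup>+x. h x \<partial>Pi\<^sub>M UNIV (\<lambda>_. N)) =
    (\<integral>\<^sup>+x. \<integral>\<^sup>+y. h (comb_seq j x y) \<partial>Pi\<^sub>M UNIV (\<lambda>_. N) \<partial>Pi\<^sub>M UNIV (\<lambda>_. N))"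
proof -
  interpret sequence_space N by (rule sequence_space_prob_space[OF N])
  have "(\<integral>\<^sup>+x. h x \<partial>S) = (\<integral>\<^sup>+x. h x \<partial>distr (S \<Otimes>\<^sub>M S) S (\<lambda>(\<omega>, \<omega>'). comb_seq j \<omega> \<omega>'))"
    by (simp only: PiM_comb_seq)
  also have "\<dots> = (\<integral>\<^sup>+z. h (case z of (\<omega>, \<omega>') \<Rightarrow> comb_seq j \<omega> \<omega>') \<partial>(S \<Otimes>\<^sub>M S))"
    by (rule nn_integral_distr) simp_all
  also have "\<dots> = (\<integral>\<^sup>+s. \<integral>\<^sup>+y. h (comb_seq j s y) \<partial>S \<partial>S)"
    by (subst P.nn_integral_fst[symmetric]) simp_all
  finally show ?thesis .
qed

text \<open>
  The three parts of an independent sequence, before, at and after position \<open>j\<close>, are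
  independent; both tails have again the law of the whole sequence.
\<close>

lemma nn_integral_PiM_split:
  assumes N: "prob_space N" and [measurable]: "h \<in> borel_measurable (Pi\<^sub>M UNIV (\<lambda>_::nat. N))"
  shows "(\<integral>\<^sup>+x. h x \<partial>Pi\<^sub>M UNIV (\<lambda>_. N)) =
    (\<integral>\<^sup>+s. \<integral>\<^sup>+x. \<integral>\<^sup>+y. h (comb_seq j x (case_nat s y)) \<partial>Pi\<^sub>M UNIV (\<lambda>_. N) \<partial>Pi\<^sub>M UNIV (\<lambda>_. N) \<partial>N)"
proof -
  interpret sequence_space N by (rule sequence_space_prob_space[OF N])
  interpret N: prob_space N by fact
  interpret NS: pair_sigma_finite N S ..
  have "(\<integral>\<^sup>+x. h x \<partial>S) = (\<integral>\<^sup>+x. \<integral>\<^sup>+y. h (comb_seq j x y) \<partial>S \<partial>S)"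
    by (rule nn_integral_PiM_comb_seq[OF N]) simp
  also have "\<dots> = (\<integral>\<^sup>+x. \<integral>\<^sup>+s. \<integral>\<^sup>+y. h (comb_seq j x (case_nat s y)) \<partial>S \<partial>N \<partial>S)"
    by (intro nn_integral_cong nn_integral_PiM_case_nat[OF N]) measurable
  also have "\<dots> = (\<integral>\<^sup>+s. \<integral>\<^sup>+x. \<integral>\<^sup>+y. h (comb_seq j x (case_nat s y)) \<partial>S \<partial>S \<partial>N)"
    by (rule NS.Fubini') measurable
  finally show ?thesis .
qed

text \<open>
  In the splitting at position \<open>j\<close>, the parts before and after it are glued to the
  sequence that remains. It is therefore independent of the omitted entry and again independent
  and identically distributed.
\<close>

lemma nn_integral_PiM_omit:
  assumes N: "prob_space N"
    and [measurable]: "f \<in> borel_measurable (N \<Otimes>\<^sub>M Pi\<^sub>M UNIV (\<lambda>_. N))"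
  shows "(\<integral>\<^sup>+x. f (x j, omit j x) \<partial>Pi\<^sub>M UNIV (\<lambda>_. N)) =
    (\<integral>\<^sup>+s. \<integral>\<^sup>+x. f (s, x) \<partial>Pi\<^sub>M UNIV (\<lambda>_. N) \<partial>N)"
proof -
  have omit: "omit j (comb_seq j x (case_nat s y)) = comb_seq j x y" for x y and s :: 'a
    by (auto simp: omit_def comb_seq_def fun_eq_iff Suc_diff_le split: nat.split)
  have nth: "comb_seq j x (case_nat s y) j = s" for x y and s :: 'a
    by (simp add: comb_seq_def)
  have "(\<integral>\<^sup>+x. f (x j, omit j x) \<partial>Pi\<^sub>M UNIV (\<lambda>_. N)) =
    (\<integral>\<^sup>+s. \<integral>\<^sup>+x. \<integral>\<^sup>+y. f (s, comb_seq j x y) \<partial>Pi\<^sub>M UNIV (\<lambda>_. N) \<partial>Pi\<^sub>M UNIV (\<lambda>_. N) \<partial>N)"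
    by (subst nn_integral_PiM_split[OF N, of _ j]) (simp_all add: omit nth)
  also have "\<dots> = (\<integral>\<^sup>+s. \<integral>\<^sup>+x. f (s, x) \<partial>Pi\<^sub>M UNIV (\<lambda>_. N) \<partial>N)"
    by (intro nn_integral_cong nn_integral_PiM_comb_seq[OF N, symmetric]) measurable
  finally show ?thesis .
qed

lemma sum_omit:
  fixes a :: "nat \<Rightarrow> 'a :: comm_monoid_add"
  assumes "j \<le> m"
  shows "(\<Sum>i<Suc m. a i) = (\<Sum>i<m. omit j a i) + a j"
  using assms
proof (induction rule: dec_induct)
  case base
  have "(\<Sum>i<j. omit j a i) = (\<Sum>i<j. a i)"
    by (rule sum.cong) (simp_all add: omit_def)
  then show ?case
    by simp
next
  case (step m)
  then have "(\<Sum>i<Suc (Suc m). a i) = (\<Sum>i<m. omit j a i) + a j + a (Suc m)"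
    by simp
  also have "\<dots> = (\<Sum>i<Suc m. omit j a i) + a j"
    using step by (simp add: omit_def ac_simps)
  finally show ?case .
qed

lemma suminf_omit:
  fixes a :: "nat \<Rightarrow> ennreal"
  shows "(\<Sum>i. a i) = (\<Sum>i. omit j a i) + a j"
proof (rule LIMSEQ_unique)
  show "(\<lambda>m. \<Sum>i<Suc m. a i) \<longlonglongrightarrow> (\<Sum>i. a i)"
    by (rule LIMSEQ_Suc) (rule summable_LIMSEQ, simp)
  have "(\<lambda>m. (\<Sum>i<m. omit j a i) + a j) \<longlonglongrightarrow> (\<Sum>i. omit j a i) + a j"
    by (intro tendsto_add summable_LIMSEQ tendsto_const) simp
  moreover have "eventually (\<lambda>m. (\<Sum>i<m. omit j a i) + a j = (\<Sum>i<Suc m. a i)) sequentially"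
    using eventually_ge_at_top[of j] by eventually_elim (rule sum_omit[symmetric])
  ultimately show "(\<lambda>m. \<Sum>i<Suc m. a i) \<longlonglongrightarrow> (\<Sum>i. omit j a i) + a j"
    by (rule Lim_transform_eventually)
qed

text \<open>
  Omitting \<open>a j\<close> leaves the compensators \<open>c\<close> in place, so from index
  \<open>j\<close> on the terms of \<open>a\<close> meet other compensators than before. Each
  partial sum thereby loses exactly one compensator, whose index tends to infinity.
\<close>

lemma sums_omit:
  fixes a c :: "nat \<Rightarrow> real"
  assumes "(\<lambda>i. a i - c i) sums y" "c \<longlonglongrightarrow> 0"
  shows "(\<lambda>i. omit j a i - c i) sums (y - a j)"
proof -
  have "(\<lambda>m. (\<Sum>i<Suc m. a i - c i) - a j + c m) \<longlonglongrightarrow> y - a j + 0"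
    using assms LIMSEQ_Suc[OF assms(1)[unfolded sums_def]] by (intro tendsto_intros) auto
  moreover have "eventually (\<lambda>m. (\<Sum>i<Suc m. a i - c i) - a j + c m = (\<Sum>i<m. omit j a i - c i)) sequentially"
    using eventually_ge_at_top[of j]
  proof eventually_elim
    case (elim m)
    then show ?case
      using sum_omit[OF elim, of a] by (simp add: sum_subtractf)
  qed
  ultimately show ?thesis
    unfolding sums_def by (auto dest: Lim_transform_eventually)
qed

section \<open>Arrival times of a Poisson process\<close>

lemma pred_greaterThanAtMost [measurable (raw)]:
  fixes f g h :: "'a \<Rightarrow> real"
  assumes [measurable]: "f \<in> borel_measurable M" "g \<in> borel_measurable M" "h \<in> borel_measurable M"
  shows "Measurable.pred M (\<lambda>x. h x \<in> {f x<..g x})"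
  unfolding greaterThanAtMost_iff by measurable

abbreviation exp_law :: "real measure" where
  "exp_law \<equiv> density lborel (\<lambda>x. ennreal (exponential_density 1 x))"

lemma prob_space_exp_law: "prob_space exp_law"
  by (rule prob_space_exponential_density) simp

text \<open>
  The density \<open>exp (- u) exp (- (w - u))\<close> of \<open>(U, U + V)\<close> on \<open>0 <
  u < w\<close> equals \<open>exp (- w)\<close> and does not depend on \<open>u\<close>.
\<close>

lemma nn_integral_exp_pair:
  fixes k :: "real \<times> real \<Rightarrow> ennreal"
  assumes [measurable]: "k \<in> borel_measurable (borel \<Otimes>\<^sub>M borel)"
  shows "(\<integral>\<^sup>+u. \<integral>\<^sup>+v. k (u, u + v) \<partial>exp_law \<partial>exp_law) =
    (\<integral>\<^sup>+w. \<integral>\<^sup>+u. k (u, w) * indicator {0<..w} u \<partial>lborel \<partial>exp_law)"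
proof -
  let ?d = "\<lambda>x. ennreal (exponential_density 1 x)"
  have "(\<integral>\<^sup>+u. \<integral>\<^sup>+v. k (u, u + v) \<partial>exp_law \<partial>exp_law) =
      (\<integral>\<^sup>+u. ?d u * (\<integral>\<^sup>+v. ?d v * k (u, u + v) \<partial>lborel) \<partial>lborel)"
    by (simp add: nn_integral_density)
  also have "\<dots> = (\<integral>\<^sup>+u. ?d u * (\<integral>\<^sup>+w. ?d (w - u) * k (u, w) \<partial>lborel) \<partial>lborel)"
  proof -
    have "(\<integral>\<^sup>+v. ?d v * k (u, u + v) \<partial>lborel) = (\<integral>\<^sup>+w. ?d (w - u) * k (u, w) \<partial>lborel)" for u
      by (subst nn_integral_real_affine[where c=1 and t="-u"]) simp_all
    then show ?thesis
      by simp
  qed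
  also have "\<dots> = (\<integral>\<^sup>+u. \<integral>\<^sup>+w. ?d u * (?d (w - u) * k (u, w)) \<partial>lborel \<partial>lborel)"
    by (intro nn_integral_cong nn_integral_cmult[symmetric]) measurable
  also have "\<dots> = (\<integral>\<^sup>+w. \<integral>\<^sup>+u. ?d u * (?d (w - u) * k (u, w)) \<partial>lborel \<partial>lborel)"
    by (rule lborel_pair.Fubini') measurable
  also have "\<dots> = (\<integral>\<^sup>+w. \<integral>\<^sup>+u. ?d w * (k (u, w) * indicator {0<..w} u) \<partial>lborel \<partial>lborel)"
  proof (rule nn_integral_cong, rule nn_integral_cong_AE)
    fix w :: real
    have "AE u in lborel. u \<noteq> (0::real)"
      by (rule AE_lborel_singleton)
    then show "AE u in lborel. ?d u * (?d (w - u) * k (u, w)) =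
        ?d w * (k (u, w) * indicator {0<..w} u)"
    proof eventually_elim
      case (elim u)
      have "?d u * ?d (w - u) = ?d w * indicator {0<..w} u"
        using elim by (auto simp: exponential_density_def indicator_def simp flip: ennreal_mult exp_add)
      then show ?case
        by (metis mult.assoc mult.commute)
    qed
  qed
  also have "\<dots> = (\<integral>\<^sup>+w. ?d w * (\<integral>\<^sup>+u. k (u, w) * indicator {0<..w} u \<partial>lborel) \<partial>lborel)"
    by (intro nn_integral_cong nn_integral_cmult) measurable
  also have "\<dots> = (\<integral>\<^sup>+w. \<integral>\<^sup>+u. k (u, w) * indicator {0<..w} u \<partial>lborel \<partial>exp_law)"
    by (rule nn_integral_density[symmetric]) measurable
  finally show ?thesis .
qed

definition partial_sums :: "(nat \<Rightarrow> real) \<Rightarrow> nat \<Rightarrow> real" where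
  "partial_sums e j = (\<Sum>k\<le>j. e k)"

lemma measurable_partial_sums [measurable]:
  "partial_sums \<in> Pi\<^sub>M UNIV (\<lambda>_. exp_law) \<rightarrow>\<^sub>M Pi\<^sub>M UNIV (\<lambda>_. borel)"
proof -
  have [measurable]: "(\<lambda>e. e k) \<in> borel_measurable (Pi\<^sub>M UNIV (\<lambda>_::nat. exp_law))" for k
    using measurable_coordinate[of k exp_law] by simp
  show ?thesis
    unfolding partial_sums_def[abs_def] by (rule measurable_PiM_single') (auto simp: space_PiM)
qed

definition arrival_law :: "(nat \<Rightarrow> real) measure" where
  "arrival_law = distr (Pi\<^sub>M UNIV (\<lambda>_. exp_law)) (Pi\<^sub>M UNIV (\<lambda>_. borel)) partial_sums"

text \<open>
  The left end of the \<open>j\<close>-th gap: gaps are counted from the origin.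
\<close>

definition previous :: "(nat \<Rightarrow> real) \<Rightarrow> nat \<Rightarrow> real" where
  "previous x j = (if j = 0 then 0 else x (j - 1))"

lemma sets_arrival_law [measurable_cong]: "sets arrival_law = sets (Pi\<^sub>M UNIV (\<lambda>_. borel))"
  by (simp add: arrival_law_def)

lemma measurable_previous [measurable]:
  "(\<lambda>x. previous x j) \<in> borel_measurable (Pi\<^sub>M UNIV (\<lambda>_. borel))"
  by (cases j) (simp_all add: previous_def)

lemma prob_space_arrival_law: "prob_space arrival_law"
proof -
  interpret sequence_space exp_law by (rule sequence_space_prob_space[OF prob_space_exp_law])
  show ?thesis
    unfolding arrival_law_def by (rule prob_space_distr) measurable
qed

lemma partial_sums_comb_seq:
  shows "partial_sums (comb_seq j x (case_nat u y)) j = (\<Sum>k<j. x k) + u"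
    and "previous (partial_sums (comb_seq j x y)) j = (\<Sum>k<j. x k)"
proof -
  have *: "(\<Sum>k<j. comb_seq j x y k) = (\<Sum>k<j. x k)" for y
    by (rule sum.cong) (simp_all add: comb_seq_def)
  show "partial_sums (comb_seq j x (case_nat u y)) j = (\<Sum>k<j. x k) + u"
    by (simp add: partial_sums_def * flip: lessThan_Suc_atMost) (simp add: comb_seq_def)
  show "previous (partial_sums (comb_seq j x y)) j = (\<Sum>k<j. x k)"
    by (cases j) (simp_all add: previous_def partial_sums_def comb_seq_def flip: lessThan_Suc_atMost)
qed

text \<open>
  Omitting an arrival merges the two adjacent waiting times \<open>u\<close> and \<open>v\<close>
  into one.
\<close>

lemma omit_partial_sums:
  "omit j (partial_sums (comb_seq j x (case_nat u (case_nat v z)))) =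
    partial_sums (comb_seq j x (case_nat (u + v) z))"
proof
  fix i
  let ?a = "comb_seq j x (case_nat u (case_nat v z))" and ?b = "comb_seq j x (case_nat (u + v) z)"
  have lt: "?a k = ?b k" if "k < j" for k
    using that by (simp add: comb_seq_def)
  have 1: "(\<Sum>k\<le>Suc (j + m). ?a k) = (\<Sum>k\<le>j + m. ?b k)" for m
  proof (induction m)
    case 0
    have "(\<Sum>k<j. ?a k) = (\<Sum>k<j. ?b k)" using lt by simp
    then show ?case
      by (simp flip: lessThan_Suc_atMost) (simp add: comb_seq_def)
  next
    case (Suc m)
    then show ?case by (simp add: comb_seq_def)
  qed
  show "omit j (partial_sums ?a) i = partial_sums ?b i"
  proof (cases "i < j")
    case True
    then show ?thesis using lt by (simp add: omit_def partial_sums_def)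
  next
    case False
    then show ?thesis using 1[of "i - j"] by (simp add: omit_def partial_sums_def)
  qed
qed

text \<open>
  Omitting the \<open>j\<close>-th arrival merges the waiting times \<open>u\<close> and
  \<open>v\<close> around it. By \<open>nn_integral_exp_pair\<close> the merged time
  \<open>w\<close> can be taken exponential, as in a sequence of arrivals, with \<open>u\<close>
  spread over \<open>(0, w]\<close> by Lebesgue measure. A shift by the previous arrival moves
  this interval onto the gap.
\<close>

lemma nn_integral_arrival_omit:
  assumes [measurable]: "f \<in> borel_measurable (borel \<Otimes>\<^sub>M Pi\<^sub>M UNIV (\<lambda>_. borel))"
  shows "(\<integral>\<^sup>+x. f (x j, omit j x) \<partial>arrival_law) =
    (\<integral>\<^sup>+x. \<integral>\<^sup>+r. f (r, x) * indicator {previous x j<..x j} r \<partial>lborel \<partial>arrival_law)"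
proof -
  interpret sequence_space exp_law by (rule sequence_space_prob_space[OF prob_space_exp_law])
  interpret X: prob_space exp_law by (rule prob_space_exp_law)
  interpret XS: pair_sigma_finite exp_law S ..
  have [measurable]: "(\<lambda>e. e k) \<in> borel_measurable S" for k
    using measurable_coordinate[of k exp_law] by simp
  note split = nn_integral_PiM_split[OF prob_space_exp_law]
  let ?h = "\<lambda>e. f (partial_sums e j, omit j (partial_sums e))"
  let ?A = "\<lambda>x::nat \<Rightarrow> real. \<Sum>k<j. x k"
  let ?P = "\<lambda>x w z. partial_sums (comb_seq j x (case_nat w z))"
  have "(\<integral>\<^sup>+x. f (x j, omit j x) \<partial>arrival_law) = (\<integral>\<^sup>+e. ?h e \<partial>S)"
    unfolding arrival_law_def by (subst nn_integral_distr) simp_all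
  also have "\<dots> = (\<integral>\<^sup>+u. \<integral>\<^sup>+x. \<integral>\<^sup>+y. ?h (comb_seq j x (case_nat u y)) \<partial>S \<partial>S \<partial>exp_law)"
    by (rule split) measurable
  also have "\<dots> = (\<integral>\<^sup>+u. \<integral>\<^sup>+x. \<integral>\<^sup>+v. \<integral>\<^sup>+z. ?h (comb_seq j x (case_nat u (case_nat v z))) \<partial>S \<partial>exp_law \<partial>S \<partial>exp_law)"
    by (intro nn_integral_cong nn_integral_PiM_case_nat[OF prob_space_exp_law]) measurable
  also have "\<dots> = (\<integral>\<^sup>+u. \<integral>\<^sup>+x. \<integral>\<^sup>+v. \<integral>\<^sup>+z. f (?A x + u, ?P x (u + v) z) \<partial>S \<partial>exp_law \<partial>S \<partial>exp_law)"
    by (simp only: omit_partial_sums partial_sums_comb_seq(1))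
  also have "\<dots> = (\<integral>\<^sup>+x. \<integral>\<^sup>+u. \<integral>\<^sup>+v. \<integral>\<^sup>+z. f (?A x + u, ?P x (u + v) z) \<partial>S \<partial>exp_law \<partial>exp_law \<partial>S)"
    by (rule XS.Fubini'[symmetric]) measurable
  also have "\<dots> = (\<integral>\<^sup>+x. \<integral>\<^sup>+w. \<integral>\<^sup>+u. (\<integral>\<^sup>+z. f (?A x + u, ?P x w z) \<partial>S) * indicator {0<..w} u \<partial>lborel \<partial>exp_law \<partial>S)"
  proof (rule nn_integral_cong)
    fix x assume "x \<in> space S"
    then have [measurable]: "(\<lambda>(u, w). \<integral>\<^sup>+z. f (?A x + u, ?P x w z) \<partial>S) \<in> borel_measurable (borel \<Otimes>\<^sub>M borel)"
      by measurable
    show "(\<integral>\<^sup>+u. \<integral>\<^sup>+v. \<integral>\<^sup>+z. f (?A x + u, ?P x (u + v) z) \<partial>S \<partial>exp_law \<partial>exp_law) =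
      (\<integral>\<^sup>+w. \<integral>\<^sup>+u. (\<integral>\<^sup>+z. f (?A x + u, ?P x w z) \<partial>S) * indicator {0<..w} u \<partial>lborel \<partial>exp_law)"
      using nn_integral_exp_pair[of "\<lambda>(u, w). \<integral>\<^sup>+z. f (?A x + u, ?P x w z) \<partial>S"] by simp
  qed
  also have "\<dots> = (\<integral>\<^sup>+x. \<integral>\<^sup>+w. \<integral>\<^sup>+r. (\<integral>\<^sup>+z. f (r, ?P x w z) \<partial>S) * indicator {?A x<..?A x + w} r \<partial>lborel \<partial>exp_law \<partial>S)"
  proof (rule nn_integral_cong, rule nn_integral_cong)
    fix x w assume "x \<in> space S"
    then show "(\<integral>\<^sup>+u. (\<integral>\<^sup>+z. f (?A x + u, ?P x w z) \<partial>S) * indicator {0<..w} u \<partial>lborel) =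
      (\<integral>\<^sup>+r. (\<integral>\<^sup>+z. f (r, ?P x w z) \<partial>S) * indicator {?A x<..?A x + w} r \<partial>lborel)"
      by (subst (2) nn_integral_real_affine[where c=1 and t="?A x"])
         (auto intro!: nn_integral_cong split: split_indicator)
  qed
  also have "\<dots> = (\<integral>\<^sup>+x. \<integral>\<^sup>+w. \<integral>\<^sup>+z. \<integral>\<^sup>+r. f (r, ?P x w z) * indicator {?A x<..?A x + w} r \<partial>lborel \<partial>S \<partial>exp_law \<partial>S)"
  proof (intro nn_integral_cong)
    fix x w assume [measurable]: "x \<in> space S" "w \<in> space exp_law"
    interpret SL: pair_sigma_finite S lborel ..
    have "(\<integral>\<^sup>+r. (\<integral>\<^sup>+z. f (r, ?P x w z) \<partial>S) * indicator {?A x<..?A x + w} r \<partial>lborel) =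
      (\<integral>\<^sup>+r. \<integral>\<^sup>+z. f (r, ?P x w z) * indicator {?A x<..?A x + w} r \<partial>S \<partial>lborel)"
      by (intro nn_integral_cong nn_integral_multc[symmetric]) measurable
    also have "\<dots> = (\<integral>\<^sup>+z. \<integral>\<^sup>+r. f (r, ?P x w z) * indicator {?A x<..?A x + w} r \<partial>lborel \<partial>S)"
      by (rule SL.Fubini') measurable
    finally show "(\<integral>\<^sup>+r. (\<integral>\<^sup>+z. f (r, ?P x w z) \<partial>S) * indicator {?A x<..?A x + w} r \<partial>lborel) =
      (\<integral>\<^sup>+z. \<integral>\<^sup>+r. f (r, ?P x w z) * indicator {?A x<..?A x + w} r \<partial>lborel \<partial>S)" .
  qed
  also have "\<dots> = (\<integral>\<^sup>+w. \<integral>\<^sup>+x. \<integral>\<^sup>+z. \<integral>\<^sup>+r. f (r, ?P x w z) * indicator {?A x<..?A x + w} r \<partial>lborel \<partial>S \<partial>S \<partial>exp_law)"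
    by (rule XS.Fubini') measurable
  also have "\<dots> = (\<integral>\<^sup>+w. \<integral>\<^sup>+x. \<integral>\<^sup>+z. (\<integral>\<^sup>+r. f (r, ?P x w z) *
      indicator {previous (?P x w z) j<..?P x w z j} r \<partial>lborel) \<partial>S \<partial>S \<partial>exp_law)"
    by (simp only: partial_sums_comb_seq)
  also have "\<dots> = (\<integral>\<^sup>+e. \<integral>\<^sup>+r. f (r, partial_sums e) *
      indicator {previous (partial_sums e) j<..partial_sums e j} r \<partial>lborel \<partial>S)"
    by (rule split[symmetric]) measurable
  also have "\<dots> = (\<integral>\<^sup>+x. \<integral>\<^sup>+r. f (r, x) * indicator {previous x j<..x j} r \<partial>lborel \<partial>arrival_law)"
    unfolding arrival_law_def by (subst nn_integral_distr) simp_all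
  finally show ?thesis .
qed

lemma disjoint_arrival_intervals:
  assumes "mono x"
  shows "disjoint_family (\<lambda>j. {previous x j<..x j})"
proof -
  have "{previous x i<..x i} \<inter> {previous x j<..x j} = {}" if "i < j" for i j
  proof -
    have "x i \<le> x (j - 1)" "j \<noteq> 0"
      using that by (auto intro!: monoD[OF assms])
    then show ?thesis
      by (auto simp: previous_def)
  qed
  then show ?thesis
    unfolding disjoint_family_on_def by (metis Int_commute linorder_neqE_nat)
qed

lemma UN_arrival_intervals:
  assumes "mono x" "0 \<le> x 0"
  shows "(\<Union>j. {previous x j<..x j}) = {r. 0 < r \<and> (\<exists>j. r \<le> x j)}"
proof (intro equalityI subsetI)
  fix r assume "r \<in> (\<Union>j. {previous x j<..x j})"
  then obtain j where "previous x j < r" "r \<le> x j"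
    by auto
  moreover have "0 \<le> previous x j"
    using assms monoD[OF assms(1), of 0 "j - 1"] by (auto simp: previous_def)
  ultimately show "r \<in> {r. 0 < r \<and> (\<exists>j. r \<le> x j)}"
    by auto
next
  fix r assume r: "r \<in> {r. 0 < r \<and> (\<exists>j. r \<le> x j)}"
  define j where "j = (LEAST j. r \<le> x j)"
  have "r \<le> x j"
    unfolding j_def using r by (auto intro: LeastI_ex)
  moreover have "previous x j < r"
    using r not_less_Least[of "j - 1" "\<lambda>j. r \<le> x j"] by (auto simp: previous_def j_def not_le)
  ultimately show "r \<in> (\<Union>j. {previous x j<..x j})"
    by auto
qed

lemma AE_arrival_law_mono: "AE x in arrival_law. mono x \<and> 0 \<le> x 0"
proof -
  have *: "AE x in exp_law. 0 \<le> x"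
    by (subst AE_density) (auto simp: exponential_density_def)
  have "AE e in Pi\<^sub>M UNIV (\<lambda>_::nat. exp_law). \<forall>k. 0 \<le> e k"
    unfolding AE_all_countable
    by (intro allI AE_PiM_component[where P="\<lambda>x. 0 \<le> x"] prob_space_exp_law UNIV_I *)
  then have "AE e in Pi\<^sub>M UNIV (\<lambda>_::nat. exp_law).
      (\<forall>k. partial_sums e k \<le> partial_sums e (Suc k)) \<and> 0 \<le> partial_sums e 0"
    by eventually_elim (simp add: partial_sums_def)
  moreover have "{x \<in> space (Pi\<^sub>M (UNIV :: nat set) (\<lambda>_. borel :: real measure)). (\<forall>k. x k \<le> x (Suc k)) \<and> 0 \<le> x 0}
      \<in> sets (Pi\<^sub>M UNIV (\<lambda>_. borel))"
    by (intro sets.sets_Collect_conj sets.sets_Collect_countable_All borel_measurable_le)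
      (rule measurable_coordinate borel_measurable_const)+
  ultimately have "AE x in arrival_law. (\<forall>k. x k \<le> x (Suc k)) \<and> 0 \<le> x 0"
    unfolding arrival_law_def by (subst AE_distr_iff[OF measurable_partial_sums])
  then show ?thesis
    by eventually_elim (auto simp: mono_iff_le_Suc)
qed

text \<open>
  The gaps of an increasing sequence are disjoint and cover the half-line up to its supremum.
\<close>

lemma suminf_arrival_omit:
  assumes [measurable]: "f \<in> borel_measurable (borel \<Otimes>\<^sub>M Pi\<^sub>M UNIV (\<lambda>_. borel))"
  shows "(\<Sum>j. \<integral>\<^sup>+x. f (x j, omit j x) \<partial>arrival_law) =
    (\<integral>\<^sup>+x. \<integral>\<^sup>+r. f (r, x) * indicator {r. 0 < r \<and> (\<exists>j. r \<le> x j)} r \<partial>lborel \<partial>arrival_law)"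
proof -
  have "(\<Sum>j. \<integral>\<^sup>+x. f (x j, omit j x) \<partial>arrival_law) =
    (\<Sum>j. \<integral>\<^sup>+x. \<integral>\<^sup>+r. f (r, x) * indicator {previous x j<..x j} r \<partial>lborel \<partial>arrival_law)"
    by (simp add: nn_integral_arrival_omit)
  also have "\<dots> = (\<integral>\<^sup>+x. (\<Sum>j. \<integral>\<^sup>+r. f (r, x) * indicator {previous x j<..x j} r \<partial>lborel) \<partial>arrival_law)"
    by (rule nn_integral_suminf[symmetric]) measurable
  also have "\<dots> = (\<integral>\<^sup>+x. \<integral>\<^sup>+r. (\<Sum>j. f (r, x) * indicator {previous x j<..x j} r) \<partial>lborel \<partial>arrival_law)"
  proof (rule nn_integral_cong, rule nn_integral_suminf[symmetric])
    fix x j assume "x \<in> space arrival_law"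
    have "x \<in> space (Pi\<^sub>M UNIV (\<lambda>_. borel))"
      by (simp add: space_PiM)
    then show "(\<lambda>r. f (r, x) * indicator {previous x j<..x j} r) \<in> borel_measurable lborel"
      by measurable
  qed
  also have "\<dots> = (\<integral>\<^sup>+x. \<integral>\<^sup>+r. f (r, x) * indicator {r. 0 < r \<and> (\<exists>j. r \<le> x j)} r \<partial>lborel \<partial>arrival_law)"
    using AE_arrival_law_mono
    by (intro nn_integral_cong_AE, eventually_elim)
       (simp add: suminf_indicator disjoint_arrival_intervals UN_arrival_intervals)
  finally show ?thesis .
qed

text \<open>
  The gap formula for \<open>f (r, x) = exp (- r)\<close> bounds the expectation of
  \<open>\<Sum>j. exp (- x j)\<close> by the integral of \<open>exp (- r)\<close> over the
  half-line. So this sum is almost surely finite and its terms tend to zero.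
\<close>

lemma AE_arrival_law_unbounded: "AE x in arrival_law. \<forall>r. \<exists>j. r \<le> x j"
proof -
  interpret prob_space arrival_law by (rule prob_space_arrival_law)
  have "(\<integral>\<^sup>+x. (\<Sum>j. ennreal (exp (- x j))) \<partial>arrival_law) =
      (\<Sum>j. \<integral>\<^sup>+x. ennreal (exp (- x j)) \<partial>arrival_law)"
    by (rule nn_integral_suminf) measurable
  also have "\<dots> = (\<integral>\<^sup>+x. \<integral>\<^sup>+r. ennreal (exp (- r)) * indicator {r. 0 < r \<and> (\<exists>j. r \<le> x j)} r \<partial>lborel \<partial>arrival_law)"
    using suminf_arrival_omit[of "\<lambda>(r, x). ennreal (exp (- r))"] by simp
  also have "\<dots> \<le> (\<integral>\<^sup>+x. \<integral>\<^sup>+r. ennreal (exponential_density 1 r) \<partial>lborel \<partial>arrival_law)"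
    by (intro nn_integral_mono) (auto simp: exponential_density_def split: split_indicator)
  also have "\<dots> = 1"
    using prob_space.emeasure_space_1[OF prob_space_exp_law]
    by (simp add: emeasure_density emeasure_space_1)
  finally have "(\<integral>\<^sup>+x. (\<Sum>j. ennreal (exp (- x j))) \<partial>arrival_law) \<noteq> \<infinity>"
    by (auto simp: top_unique)
  then have "AE x in arrival_law. (\<Sum>j. ennreal (exp (- x j))) \<noteq> \<infinity>"
    by (intro nn_integral_noteq_infinite) measurable
  then show ?thesis
  proof eventually_elim
    case (elim x)
    have "summable (\<lambda>j. exp (- x j))"
      using elim by (intro summable_suminf_not_top) auto
    then have lim: "(\<lambda>j. exp (- x j)) \<longlonglongrightarrow> 0"
      by (rule summable_LIMSEQ_zero)
    show ?case
    proof
      fix r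
      have "eventually (\<lambda>j. exp (- x j) < exp (- r)) sequentially"
        using lim by (rule order_tendstoD) simp
      then have "\<exists>j. exp (- x j) < exp (- r)"
        by (intro eventually_happens'[OF sequentially_bot])
      then obtain j where "exp (- x j) < exp (- r)" ..
      then show "\<exists>j. r \<le> x j"
        by (intro exI[of _ j]) simp
    qed
  qed
qed

text \<open>
  Mecke's formula for a Poisson process on the half-line with Lebesgue intensity.
\<close>

lemma Mecke_arrivals:
  assumes [measurable]: "f \<in> borel_measurable (borel \<Otimes>\<^sub>M Pi\<^sub>M UNIV (\<lambda>_. borel))"
  shows "(\<Sum>j. \<integral>\<^sup>+x. f (x j, omit j x) \<partial>arrival_law) =
    (\<integral>\<^sup>+x. \<integral>\<^sup>+r. f (r, x) * indicator {0<..} r \<partial>lborel \<partial>arrival_law)"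
proof -
  have "AE x in arrival_law. (\<integral>\<^sup>+r. f (r, x) * indicator {r. 0 < r \<and> (\<exists>j. r \<le> x j)} r \<partial>lborel) =
      (\<integral>\<^sup>+r. f (r, x) * indicator {0<..} r \<partial>lborel)"
    using AE_arrival_law_unbounded
  proof eventually_elim
    case (elim x)
    then have "{r. 0 < r \<and> (\<exists>j. r \<le> x j)} = {0<..}"
      by auto
    then show ?case
      by simp
  qed
  then show ?thesis
    unfolding suminf_arrival_omit[OF assms] by (rule nn_integral_cong_AE)
qed

section \<open>Mecke's formula for the active points\<close>

text \<open>
  The marks have the law \<open>g dn\<close>; they are attached to the arrivals of a Poisson
  process on the half-line.
\<close>

locale marked_arrivals = sigma_finite_measure n
  for n :: "'s measure" +
  fixes g :: "'s \<Rightarrow> real"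
  assumes g_measurable [measurable]: "g \<in> borel_measurable n"
    and g_pos: "AE s in n. 0 < g s"
    and prob_space_mark_law: "prob_space (density n (\<lambda>s. ennreal (g s)))"
begin

definition mark_law :: "'s measure" where
  "mark_law = density n (\<lambda>s. ennreal (g s))"

definition config_law :: "((nat \<Rightarrow> 's) \<times> (nat \<Rightarrow> real)) measure" where
  "config_law = Pi\<^sub>M UNIV (\<lambda>_. mark_law) \<Otimes>\<^sub>M arrival_law"

definition omit_point :: "nat \<Rightarrow> (nat \<Rightarrow> 's) \<times> (nat \<Rightarrow> real) \<Rightarrow> (nat \<Rightarrow> 's) \<times> (nat \<Rightarrow> real)" where
  "omit_point j z = (omit j (fst z), omit j (snd z))"

text \<open>
  The point \<open>(s, r)\<close> of the marked process is retained if \<open>r \<le> 1 / g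
  s\<close>. Projected to the marks, the retained points have intensity \<open>g s * (1 / g
  s)\<close> with respect to \<open>n\<close>.
\<close>

definition active :: "nat \<Rightarrow> (nat \<Rightarrow> 's) \<times> (nat \<Rightarrow> real) \<Rightarrow> bool" where
  "active j z \<longleftrightarrow> g (fst z j) \<le> inverse (snd z j)"

lemma sets_mark_law [measurable_cong, simp]: "sets mark_law = sets n"
  by (simp add: mark_law_def)

lemma sets_PiM_mark_law: "sets (Pi\<^sub>M UNIV (\<lambda>_::nat. mark_law)) = sets (Pi\<^sub>M UNIV (\<lambda>_. n))"
  by (rule sets_PiM_cong) simp_all

lemma sets_config_law [measurable_cong]:
  "sets config_law = sets (Pi\<^sub>M UNIV (\<lambda>_. n) \<Otimes>\<^sub>M Pi\<^sub>M UNIV (\<lambda>_. borel))"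
  unfolding config_law_def
  by (rule sets_pair_measure_cong) (simp_all add: sets_PiM_mark_law sets_arrival_law)

lemma prob_space_config_law: "prob_space config_law"
proof -
  interpret mark: prob_space mark_law
    unfolding mark_law_def by (rule prob_space_mark_law)
  interpret marks: sequence_space mark_law
    by (rule sequence_space_prob_space) (rule mark.prob_space_axioms)
  interpret arrivals: prob_space arrival_law by (rule prob_space_arrival_law)
  interpret pair_prob_space marks.S arrival_law ..
  show ?thesis
    unfolding config_law_def by (rule prob_space_axioms)
qed

lemma measurable_omit_point [measurable]:
  "omit_point j \<in> Pi\<^sub>M UNIV (\<lambda>_. n) \<Otimes>\<^sub>M Pi\<^sub>M UNIV (\<lambda>_. borel) \<rightarrow>\<^sub>M Pi\<^sub>M UNIV (\<lambda>_. n) \<Otimes>\<^sub>M Pi\<^sub>M UNIV (\<lambda>_. borel)"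
  unfolding omit_point_def[abs_def] by measurable

lemma measurable_fst_nth [measurable]:
  "(\<lambda>z. fst z j) \<in> Pi\<^sub>M UNIV (\<lambda>_. n) \<Otimes>\<^sub>M Pi\<^sub>M UNIV (\<lambda>_::nat. borel :: real measure) \<rightarrow>\<^sub>M n"
  by (rule measurable_compose[OF measurable_fst measurable_coordinate])

lemma measurable_snd_nth [measurable]:
  "(\<lambda>z. snd z j) \<in> borel_measurable (Pi\<^sub>M UNIV (\<lambda>_::nat. n) \<Otimes>\<^sub>M Pi\<^sub>M UNIV (\<lambda>_. borel :: real measure))"
  by (rule measurable_compose[OF measurable_snd measurable_coordinate])

lemma measurable_active [measurable]:
  "Measurable.pred (Pi\<^sub>M UNIV (\<lambda>_. n) \<Otimes>\<^sub>M Pi\<^sub>M UNIV (\<lambda>_. borel)) (active j)"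
  unfolding active_def[abs_def] by measurable

text \<open>
  Marks and arrivals are independent, so one omits from both sequences at once.
\<close>

lemma Mecke_marked:
  assumes "h \<in> borel_measurable ((n \<Otimes>\<^sub>M borel) \<Otimes>\<^sub>M (Pi\<^sub>M UNIV (\<lambda>_. n) \<Otimes>\<^sub>M Pi\<^sub>M UNIV (\<lambda>_. borel)))"
  shows "(\<Sum>j. \<integral>\<^sup>+z. h ((fst z j, snd z j), omit_point j z) \<partial>config_law) =
    (\<integral>\<^sup>+z. \<integral>\<^sup>+s. \<integral>\<^sup>+r. h ((s, r), z) * indicator {0<..} r \<partial>lborel \<partial>mark_law \<partial>config_law)"
proof -
  interpret mark: prob_space mark_law
    unfolding mark_law_def by (rule prob_space_mark_law)
  interpret marks: sequence_space mark_law
    by (rule sequence_space_prob_space) (rule mark.prob_space_axioms)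
  interpret arrivals: prob_space arrival_law by (rule prob_space_arrival_law)
  interpret SA: pair_sigma_finite marks.S arrival_law ..
  interpret NS: pair_sigma_finite mark_law marks.S ..
  interpret LS: pair_sigma_finite lborel marks.S ..
  interpret NL: pair_sigma_finite mark_law lborel ..
  let ?S = "marks.S" and ?A = arrival_law and ?N = mark_law
  have [measurable]: "h \<in> borel_measurable ((?N \<Otimes>\<^sub>M borel) \<Otimes>\<^sub>M (?S \<Otimes>\<^sub>M Pi\<^sub>M UNIV (\<lambda>_. borel)))"
    using assms by (subst measurable_cong_sets[OF sets_pair_measure_cong refl])
      (auto intro!: sets_pair_measure_cong simp: sets_PiM_mark_law)
  have [measurable]: "(\<lambda>z. fst z k) \<in> ?S \<Otimes>\<^sub>M ?A \<rightarrow>\<^sub>M ?N" "(\<lambda>x. x k) \<in> ?S \<rightarrow>\<^sub>M ?N"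
    "(\<lambda>z. snd z k) \<in> borel_measurable (?S \<Otimes>\<^sub>M ?A)" for k
  proof -
    show 1: "(\<lambda>x. x k) \<in> ?S \<rightarrow>\<^sub>M ?N"
      by (rule measurable_coordinate)
    show "(\<lambda>z. fst z k) \<in> ?S \<Otimes>\<^sub>M ?A \<rightarrow>\<^sub>M ?N"
      by (rule measurable_compose[OF measurable_fst 1])
    have "(\<lambda>x. x k) \<in> borel_measurable ?A"
      by (subst measurable_cong_sets[OF sets_arrival_law refl]) (rule measurable_coordinate)
    then show "(\<lambda>z. snd z k) \<in> borel_measurable (?S \<Otimes>\<^sub>M ?A)"
      by (rule measurable_compose[OF measurable_snd])
  qed
  \<comment> \<open>Marks are integrated out first, so that what remains is a functional of the arrivals alone.\<close>
  define H where "H = (\<lambda>(r, y). \<integral>\<^sup>+s. \<integral>\<^sup>+x. h ((s, r), (x, y)) \<partial>?S \<partial>?N)"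
  have H [measurable]: "H \<in> borel_measurable (borel \<Otimes>\<^sub>M Pi\<^sub>M UNIV (\<lambda>_. borel))"
    unfolding H_def by measurable
  have "(\<integral>\<^sup>+z. h ((fst z j, snd z j), omit_point j z) \<partial>config_law) = (\<integral>\<^sup>+y. H (y j, omit j y) \<partial>?A)" for j
  proof -
    have "(\<integral>\<^sup>+z. h ((fst z j, snd z j), omit_point j z) \<partial>config_law) =
      (\<integral>\<^sup>+y. \<integral>\<^sup>+x. h ((x j, y j), (omit j x, omit j y)) \<partial>?S \<partial>?A)"
      unfolding config_law_def
      by (subst SA.nn_integral_snd[symmetric]) (simp_all add: omit_point_def case_prod_beta')
    also have "\<dots> = (\<integral>\<^sup>+y. \<integral>\<^sup>+s. \<integral>\<^sup>+x. h ((s, y j), (x, omit j y)) \<partial>?S \<partial>?N \<partial>?A)"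
    proof (rule nn_integral_cong)
      fix y assume "y \<in> space ?A"
      then have [measurable]: "y \<in> space (Pi\<^sub>M UNIV (\<lambda>_. borel))" "omit j y \<in> space (Pi\<^sub>M UNIV (\<lambda>_. borel))"
        by (simp_all add: space_PiM)
      show "(\<integral>\<^sup>+x. h ((x j, y j), (omit j x, omit j y)) \<partial>?S) =
          (\<integral>\<^sup>+s. \<integral>\<^sup>+x. h ((s, y j), (x, omit j y)) \<partial>?S \<partial>?N)"
        using nn_integral_PiM_omit[OF mark.prob_space_axioms, of "\<lambda>(s, x). h ((s, y j), (x, omit j y))" j]
        by simp
    qed
    finally show ?thesis by (simp add: H_def)
  qed
  then have "(\<Sum>j. \<integral>\<^sup>+z. h ((fst z j, snd z j), omit_point j z) \<partial>config_law) =
      (\<integral>\<^sup>+y. \<integral>\<^sup>+r. H (r, y) * indicator {0<..} r \<partial>lborel \<partial>?A)"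
    by (simp add: Mecke_arrivals[OF H])
  also have "\<dots> = (\<integral>\<^sup>+y. \<integral>\<^sup>+x. \<integral>\<^sup>+s. \<integral>\<^sup>+r. h ((s, r), (x, y)) * indicator {0<..} r \<partial>lborel \<partial>?N \<partial>?S \<partial>?A)"
  proof (rule nn_integral_cong)
    fix y assume "y \<in> space ?A"
    then have [measurable]: "y \<in> space (Pi\<^sub>M UNIV (\<lambda>_. borel))"
      by (simp add: space_PiM)
    have "(\<integral>\<^sup>+r. H (r, y) * indicator {0<..} r \<partial>lborel) =
        (\<integral>\<^sup>+r. (\<integral>\<^sup>+s. \<integral>\<^sup>+x. h ((s, r), (x, y)) * indicator {0<..} r \<partial>?S \<partial>?N) \<partial>lborel)"
      by (auto intro!: nn_integral_cong simp: H_def split: split_indicator)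
    also have "\<dots> = (\<integral>\<^sup>+s. \<integral>\<^sup>+r. \<integral>\<^sup>+x. h ((s, r), (x, y)) * indicator {0<..} r \<partial>?S \<partial>lborel \<partial>?N)"
      by (rule NL.Fubini') measurable
    also have "\<dots> = (\<integral>\<^sup>+s. \<integral>\<^sup>+x. \<integral>\<^sup>+r. h ((s, r), (x, y)) * indicator {0<..} r \<partial>lborel \<partial>?S \<partial>?N)"
      by (rule nn_integral_cong, rule LS.Fubini'[symmetric]) measurable
    also have "\<dots> = (\<integral>\<^sup>+x. \<integral>\<^sup>+s. \<integral>\<^sup>+r. h ((s, r), (x, y)) * indicator {0<..} r \<partial>lborel \<partial>?N \<partial>?S)"
      by (rule NS.Fubini'[symmetric]) measurable
    finally show "(\<integral>\<^sup>+r. H (r, y) * indicator {0<..} r \<partial>lborel) = \<dots>" .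
  qed
  also have "\<dots> = (\<integral>\<^sup>+z. \<integral>\<^sup>+s. \<integral>\<^sup>+r. h ((s, r), z) * indicator {0<..} r \<partial>lborel \<partial>?N \<partial>config_law)"
    unfolding config_law_def
    by (subst SA.nn_integral_snd[symmetric]) (simp_all add: case_prod_beta')
  finally show ?thesis .
qed

text \<open>
  For fixed \<open>s\<close> the active times fill the interval \<open>(0, 1 / g s]\<close>, whose
  length cancels the density \<open>g s\<close> of the mark law.
\<close>

theorem Mecke_active:
  assumes [measurable]: "f \<in> borel_measurable (n \<Otimes>\<^sub>M (Pi\<^sub>M UNIV (\<lambda>_. n) \<Otimes>\<^sub>M Pi\<^sub>M UNIV (\<lambda>_. borel)))"
  shows "(\<Sum>j. \<integral>\<^sup>+z. f (fst z j, omit_point j z) * of_bool (active j z) \<partial>config_law) =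
    (\<integral>\<^sup>+z. \<integral>\<^sup>+s. f (s, z) \<partial>n \<partial>config_law)"
proof -
  let ?h = "\<lambda>p. f (fst (fst p), snd p) * of_bool (g (fst (fst p)) \<le> inverse (snd (fst p)))"
  have h: "?h \<in> borel_measurable ((n \<Otimes>\<^sub>M borel) \<Otimes>\<^sub>M (Pi\<^sub>M UNIV (\<lambda>_. n) \<Otimes>\<^sub>M Pi\<^sub>M UNIV (\<lambda>_. borel)))"
    by measurable
  have "(\<Sum>j. \<integral>\<^sup>+z. f (fst z j, omit_point j z) * of_bool (active j z) \<partial>config_law) =
    (\<integral>\<^sup>+z. \<integral>\<^sup>+s. \<integral>\<^sup>+r. ?h ((s, r), z) * indicator {0<..} r \<partial>lborel \<partial>mark_law \<partial>config_law)"
    using Mecke_marked[OF h] by (simp add: active_def)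
  also have "\<dots> = (\<integral>\<^sup>+z. \<integral>\<^sup>+s. f (s, z) \<partial>n \<partial>config_law)"
  proof (rule nn_integral_cong)
    fix z assume "z \<in> space config_law"
    then have [measurable]: "z \<in> space (Pi\<^sub>M UNIV (\<lambda>_. n) \<Otimes>\<^sub>M Pi\<^sub>M UNIV (\<lambda>_. borel))"
      using sets_eq_imp_space_eq[OF sets_config_law] by simp
    have "(\<integral>\<^sup>+s. \<integral>\<^sup>+r. ?h ((s, r), z) * indicator {0<..} r \<partial>lborel \<partial>mark_law) =
        (\<integral>\<^sup>+s. ennreal (g s) * (\<integral>\<^sup>+r. ?h ((s, r), z) * indicator {0<..} r \<partial>lborel) \<partial>n)"
      unfolding mark_law_def by (rule nn_integral_density) measurable
    also have "\<dots> = (\<integral>\<^sup>+s. f (s, z) \<partial>n)"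
    proof (rule nn_integral_cong_AE)
      show "AE s in n. ennreal (g s) * (\<integral>\<^sup>+r. ?h ((s, r), z) * indicator {0<..} r \<partial>lborel) = f (s, z)"
        using g_pos
      proof eventually_elim
        case (elim s)
        have "?h ((s, r), z) * indicator {0<..} r = f (s, z) * indicator {0<..1 / g s} r" for r
          using elim by (auto simp: field_simps split: split_indicator)
        then have "(\<integral>\<^sup>+r. ?h ((s, r), z) * indicator {0<..} r \<partial>lborel) = f (s, z) * ennreal (1 / g s)"
          using elim by (simp add: nn_integral_cmult_indicator)
        moreover have "ennreal (g s) * ennreal (1 / g s) = 1"
          using elim by (simp flip: ennreal_mult)
        ultimately show ?case
          by (simp add: mult.left_commute[of "ennreal (g s)"])
      qed
    qed
    finally show "(\<integral>\<^sup>+s. \<integral>\<^sup>+r. ?h ((s, r), z) * indicator {0<..} r \<partial>lborel \<partial>mark_law) = (\<integral>\<^sup>+s. f (s, z) \<partial>n)" .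
  qed
  finally show ?thesis .
qed

end

section \<open>Compensated sums over the active points\<close>

text \<open>
  Near infinity this is the decay of the cutoff, on bounded sets its boundedness.
\<close>

lemma cutoff_function_bounded:
  assumes "cutoff_function \<kappa>"
  shows "\<exists>C. \<forall>v. \<bar>v * \<kappa> v\<bar> \<le> C"
proof -
  obtain B where B: "\<And>v. \<bar>\<kappa> v\<bar> \<le> B"
    using assms by (auto simp: cutoff_function_def bounded_iff)
  obtain c where "eventually (\<lambda>v. norm (\<kappa> v) \<le> c * norm (inverse \<bar>v\<bar>)) at_infinity"
    using assms by (auto simp: cutoff_function_def elim: landau_o.bigE)
  then obtain K where K: "\<And>v. K \<le> \<bar>v\<bar> \<Longrightarrow> \<bar>\<kappa> v\<bar> \<le> c * inverse \<bar>v\<bar>"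
    by (auto simp: eventually_at_infinity)
  have "\<bar>v * \<kappa> v\<bar> \<le> max \<bar>c\<bar> (\<bar>K\<bar> * B)" for v
  proof (cases "K \<le> \<bar>v\<bar>")
    case True
    have "\<bar>v * \<kappa> v\<bar> \<le> \<bar>v\<bar> * (c * inverse \<bar>v\<bar>)"
      unfolding abs_mult using K[OF True] by (intro mult_left_mono) auto
    also have "\<dots> \<le> \<bar>c\<bar>"
      by (cases "v = 0") (auto simp: field_simps)
    finally show ?thesis
      by simp
  next
    case False
    then have "\<bar>v * \<kappa> v\<bar> \<le> \<bar>K\<bar> * B"
      unfolding abs_mult using B[of v] by (intro mult_mono) auto
    then show ?thesis
      by simp
  qed
  then show ?thesis
    by blast
qed

lemma truncation_increment_bounds:
  fixes x :: real
  assumes "0 \<le> x"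
  shows "\<bar>min (real (j + 1) * x) 1 - min (real j * x) 1\<bar> \<le> x"
  using assms by (auto simp: min_def algebra_simps)

lemma truncation_increment_tendsto_0:
  fixes x :: real
  assumes "0 < x"
  shows "(\<lambda>j. min (real (j + 1) * x) 1 - min (real j * x) 1) \<longlonglongrightarrow> 0"
proof (rule tendsto_eventually)
  obtain k where k: "1 < real k * x"
    using reals_Archimedean3[OF assms, rule_format, of 1] by blast
  show "eventually (\<lambda>j. min (real (j + 1) * x) 1 - min (real j * x) 1 = 0) sequentially"
    using eventually_ge_at_top[of k]
  proof eventually_elim
    case (elim j)
    have "real k * x \<le> real j * x"
      using elim assms by simp
    moreover have "real j * x \<le> real (j + 1) * x"
      using assms by simp
    ultimately show ?case
      using k by (simp add: min_def)
  qed
qed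

context marked_arrivals
begin

text \<open>
  Dominated convergence with a multiple of \<open>g\<close> as dominating function: the increments
  of \<open>min (j * g s) 1\<close> in \<open>j\<close> are at most \<open>g s\<close>, and they
  vanish once \<open>j * g s\<close> exceeds one.
\<close>

lemma compensator_tendsto_0:
  assumes \<kappa>: "cutoff_function \<kappa>" and v [measurable]: "v \<in> borel_measurable n"
  shows "(\<lambda>j. \<integral>s. v s * \<kappa> (v s) * (min (real (j + 1) * g s) 1 - min (real j * g s) 1) \<partial>n) \<longlonglongrightarrow> 0"
proof -
  have [measurable]: "\<kappa> \<in> borel_measurable borel"
    using \<kappa> by (simp add: cutoff_function_def)
  obtain C where C: "\<And>x. \<bar>x * \<kappa> x\<bar> \<le> C"
    using cutoff_function_bounded[OF \<kappa>] by blast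
  have "integrable n g"
  proof (rule integrableI_bounded)
    have "(\<integral>\<^sup>+s. ennreal (norm (g s)) \<partial>n) = (\<integral>\<^sup>+s. ennreal (g s) \<partial>n)"
      using g_pos by (intro nn_integral_cong_AE) (auto elim!: eventually_mono)
    also have "\<dots> = 1"
      using prob_space.emeasure_space_1[OF prob_space_mark_law]
      by (simp add: emeasure_density cong: nn_integral_cong)
    finally show "(\<integral>\<^sup>+s. ennreal (norm (g s)) \<partial>n) < \<infinity>"
      by simp
  qed simp
  have "(\<lambda>j. \<integral>s. v s * \<kappa> (v s) * (min (real (j + 1) * g s) 1 - min (real j * g s) 1) \<partial>n) \<longlonglongrightarrow> (\<integral>s. 0 \<partial>n)"
  proof (rule integral_dominated_convergence[where w="\<lambda>s. C * g s"])
    show "integrable n (\<lambda>s. C * g s)"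
      using \<open>integrable n g\<close> by simp
    show "AE s in n. (\<lambda>j. v s * \<kappa> (v s) * (min (real (j + 1) * g s) 1 - min (real j * g s) 1)) \<longlonglongrightarrow> 0"
      using g_pos by eventually_elim (intro tendsto_mult_right_zero truncation_increment_tendsto_0)
    show "AE s in n. norm (v s * \<kappa> (v s) * (min (real (j + 1) * g s) 1 - min (real j * g s) 1)) \<le> C * g s" for j
      using g_pos
    proof eventually_elim
      case (elim s)
      then show ?case
        unfolding real_norm_def abs_mult[of "v s * \<kappa> (v s)"]
        using C truncation_increment_bounds[of "g s" j] order_trans[OF abs_ge_zero C]
        by (intro mult_mono) auto
    qed
  qed measurable
  then show ?thesis
    by simp
qed

definition point_sum :: "('s \<Rightarrow> ennreal) \<Rightarrow> (nat \<Rightarrow> 's) \<times> (nat \<Rightarrow> real) \<Rightarrow> ennreal" where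
  "point_sum h z = (\<Sum>j. h (fst z j) * of_bool (active j z))"

definition compensated_sum ::
    "('t \<Rightarrow> 's \<Rightarrow> real) \<Rightarrow> ('t \<Rightarrow> nat \<Rightarrow> real) \<Rightarrow> (nat \<Rightarrow> 's) \<times> (nat \<Rightarrow> real) \<Rightarrow> 't \<Rightarrow> real" where
  "compensated_sum V c z t = (\<Sum>j. V t (fst z j) * of_bool (active j z) - c t j)"

lemma measurable_point_sum [measurable]:
  assumes [measurable]: "h \<in> borel_measurable n"
  shows "point_sum h \<in> borel_measurable (Pi\<^sub>M UNIV (\<lambda>_. n) \<Otimes>\<^sub>M Pi\<^sub>M UNIV (\<lambda>_. borel))"
  unfolding point_sum_def[abs_def] by measurable

lemma measurable_compensated_sum:
  assumes [measurable]: "\<And>t. V t \<in> borel_measurable n"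
  shows "compensated_sum V c \<in> Pi\<^sub>M UNIV (\<lambda>_. n) \<Otimes>\<^sub>M Pi\<^sub>M UNIV (\<lambda>_. borel) \<rightarrow>\<^sub>M path_space"
  by (rule measurable_PiM_single')
    (auto simp: compensated_sum_def space_PiM intro!: borel_measurable_suminf)

lemma point_sum_omit:
  "point_sum h z = point_sum h (omit_point j z) + h (fst z j) * of_bool (active j z)"
proof -
  have "omit j (\<lambda>i. h (fst z i) * of_bool (active i z)) =
      (\<lambda>i. h (fst (omit_point j z) i) * of_bool (active i (omit_point j z)))"
    by (auto simp: omit_def omit_point_def active_def)
  then show ?thesis
    using suminf_omit[of "\<lambda>i. h (fst z i) * of_bool (active i z)" j]
    by (simp add: point_sum_def)
qed

lemma compensated_sum_omit:
  assumes "summable (\<lambda>j. V t (fst z j) * of_bool (active j z) - c t j)" "c t \<longlonglongrightarrow> 0"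
  shows "compensated_sum V c z t =
    compensated_sum V c (omit_point j z) t + V t (fst z j) * of_bool (active j z)"
proof -
  let ?a = "\<lambda>i. V t (fst z i) * of_bool (active i z)"
  have "omit j ?a = (\<lambda>i. V t (fst (omit_point j z) i) * of_bool (active i (omit_point j z)))"
    by (auto simp: omit_def omit_point_def active_def)
  then have "(\<lambda>i. V t (fst (omit_point j z) i) * of_bool (active i (omit_point j z)) - c t i)
      sums (compensated_sum V c z t - ?a j)"
    using sums_omit[of ?a "c t" _ j] assms by (simp add: compensated_sum_def summable_sums)
  then show ?thesis
    by (simp add: compensated_sum_def sums_iff)
qed

text \<open>
  Write the last factor \<open>point_sum h z\<close> on the left as a sum over the active points.
  In the \<open>j\<close>-th term, express the functionals through the configuration without its
  \<open>j\<close>-th point, and apply Mecke's formula to each term.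
\<close>

theorem Mecke_functional:
  assumes V [measurable]: "\<And>t. V t \<in> borel_measurable n"
    and c: "\<And>t. c t \<longlonglongrightarrow> 0"
    and conv: "\<And>t. AE z in config_law. summable (\<lambda>j. V t (fst z j) * of_bool (active j z) - c t j)"
    and F [measurable]: "F \<in> borel_measurable path_space"
    and \<phi> [measurable]: "\<phi> \<in> borel_measurable borel"
    and h [measurable]: "h \<in> borel_measurable n"
  shows "(\<integral>\<^sup>+z. F (compensated_sum V c z) * \<phi> (point_sum h z) * point_sum h z \<partial>config_law) =
    (\<integral>\<^sup>+z. \<integral>\<^sup>+s. F (\<lambda>t. V t s + compensated_sum V c z t) * \<phi> (point_sum h z + h s) * h s \<partial>n \<partial>config_law)"
proof -
  let ?C = "Pi\<^sub>M UNIV (\<lambda>_::nat. n) \<Otimes>\<^sub>M Pi\<^sub>M UNIV (\<lambda>_::nat. borel :: real measure)"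
  note [measurable] = measurable_compensated_sum[OF V, where c=c]
  have shift [measurable]: "(\<lambda>(s, z) t. V t s + compensated_sum V c z t) \<in> n \<Otimes>\<^sub>M ?C \<rightarrow>\<^sub>M path_space"
  proof (rule measurable_PiM_single')
    show "(\<lambda>\<omega>. (case \<omega> of (s, z) \<Rightarrow> \<lambda>t. V t s + compensated_sum V c z t) t) \<in> borel_measurable (n \<Otimes>\<^sub>M ?C)" for t
    proof -
      have [measurable]: "(\<lambda>z. compensated_sum V c z t) \<in> borel_measurable ?C"
        by (rule measurable_compose[OF measurable_compensated_sum[OF V] measurable_coordinate])
      show ?thesis
        by (simp add: case_prod_beta')
    qed
  qed (simp add: space_PiM)
  define f where "f = (\<lambda>(s, z). F (\<lambda>t. V t s + compensated_sum V c z t) * \<phi> (point_sum h z + h s) * h s)"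
  have f [measurable]: "f \<in> borel_measurable (n \<Otimes>\<^sub>M ?C)"
  proof -
    have [measurable]: "(\<lambda>p. F ((\<lambda>(s, z) t. V t s + compensated_sum V c z t) p)) \<in> borel_measurable (n \<Otimes>\<^sub>M ?C)"
      by (rule measurable_compose[OF shift F])
    have "f = (\<lambda>p. F ((\<lambda>(s, z) t. V t s + compensated_sum V c z t) p) *
        \<phi> (point_sum h (snd p) + h (fst p)) * h (fst p))"
      by (auto simp: f_def)
    then show ?thesis
      by simp
  qed
  have term_eq: "AE z in config_law. F (compensated_sum V c z) * \<phi> (point_sum h z) * (h (fst z j) * of_bool (active j z)) =
      f (fst z j, omit_point j z) * of_bool (active j z)" for j
  proof -
    \<comment> \<open>The indicator keeps the inactive case an identity too, where the \<open>j\<close>-th point adds nothing.\<close>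
    have "AE z in config_law. F (compensated_sum V c z) =
        F (\<lambda>t. V t (fst z j) * of_bool (active j z) + compensated_sum V c (omit_point j z) t)"
    proof (rule AE_path_functional_eq[OF F])
      show "AE z in config_law. compensated_sum V c z t =
          V t (fst z j) * of_bool (active j z) + compensated_sum V c (omit_point j z) t" for t
        using conv[of t] by eventually_elim (simp add: compensated_sum_omit[where j=j, OF _ c])
    qed
    then show ?thesis
    proof eventually_elim
      case (elim z)
      then show ?case
        using point_sum_omit[of h z j] by (auto simp: f_def)
    qed
  qed
  have "(\<integral>\<^sup>+z. F (compensated_sum V c z) * \<phi> (point_sum h z) * point_sum h z \<partial>config_law) =
      (\<integral>\<^sup>+z. (\<Sum>j. F (compensated_sum V c z) * \<phi> (point_sum h z) * (h (fst z j) * of_bool (active j z))) \<partial>config_law)"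
    by (simp add: point_sum_def)
  also have "\<dots> = (\<Sum>j. \<integral>\<^sup>+z. F (compensated_sum V c z) * \<phi> (point_sum h z) * (h (fst z j) * of_bool (active j z)) \<partial>config_law)"
    by (rule nn_integral_suminf) measurable
  also have "\<dots> = (\<Sum>j. \<integral>\<^sup>+z. f (fst z j, omit_point j z) * of_bool (active j z) \<partial>config_law)"
    using term_eq by (intro suminf_cong nn_integral_cong_AE)
  also have "\<dots> = (\<integral>\<^sup>+z. \<integral>\<^sup>+s. f (s, z) \<partial>n \<partial>config_law)"
    by (rule Mecke_active[OF f])
  finally show ?thesis
    by (simp add: f_def)
qed

text \<open>
  Let \<open>N\<close> be the number of active points in the set \<open>A\<close> where
  \<open>h\<close> is positive. The function \<open>\<phi> = 1\<^bsub>{1}\<^esub>\<close> selects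
  \<open>N = 1\<close> on the left of Mecke's formula and \<open>N = 0\<close> on the right, where
  the integral over \<open>s\<close> contributes the infinite factor \<open>n A\<close>.
\<close>

lemma AE_point_sum_pos:
  assumes h [measurable]: "h \<in> borel_measurable n" and inf: "emeasure n {s \<in> space n. 0 < h s} = \<infinity>"
  shows "AE z in config_law. 0 < point_sum h z"
proof -
  interpret prob_space config_law by (rule prob_space_config_law)
  let ?A = "{s \<in> space n. 0 < h s}"
  let ?k = "indicator ?A :: 's \<Rightarrow> ennreal"
  have A [measurable]: "?A \<in> sets n"
    by measurable
  have "(\<integral>\<^sup>+z. 1 * indicator {1} (point_sum ?k z) * point_sum ?k z \<partial>config_law) =
    (\<integral>\<^sup>+z. \<integral>\<^sup>+s. 1 * indicator {1} (point_sum ?k z + ?k s) * ?k s \<partial>n \<partial>config_law)"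
    using Mecke_functional[of "\<lambda>t s. 0" "\<lambda>t j. 0" "\<lambda>_. 1" "indicator {1}" ?k] by simp
  also have "\<dots> = (\<integral>\<^sup>+z. \<infinity> * indicator {0} (point_sum ?k z) \<partial>config_law)"
  proof (rule nn_integral_cong)
    fix z
    have "(\<integral>\<^sup>+s. 1 * indicator {1} (point_sum ?k z + ?k s) * ?k s \<partial>n) =
        (\<integral>\<^sup>+s. indicator {0} (point_sum ?k z) * ?k s \<partial>n)"
      by (intro nn_integral_cong) (auto split: split_indicator)
    also have "\<dots> = \<infinity> * indicator {0} (point_sum ?k z)"
      using inf by (subst nn_integral_cmult_indicator[OF A]) (simp add: mult.commute)
    finally show "(\<integral>\<^sup>+s. 1 * indicator {1} (point_sum ?k z + ?k s) * ?k s \<partial>n) = \<dots>" .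
  qed
  finally have eq: "(\<integral>\<^sup>+z. \<infinity> * indicator {0} (point_sum ?k z) \<partial>config_law) =
      (\<integral>\<^sup>+z. 1 * indicator {1} (point_sum ?k z) * point_sum ?k z \<partial>config_law)" ..
  also have "\<dots> \<le> (\<integral>\<^sup>+z. 1 \<partial>config_law)"
    by (intro nn_integral_mono) (auto split: split_indicator)
  also have "\<dots> = 1"
    by (simp add: emeasure_space_1)
  finally have "(\<integral>\<^sup>+z. \<infinity> * indicator {0} (point_sum ?k z) \<partial>config_law) \<noteq> \<infinity>"
    by (auto simp: top_unique)
  then have "AE z in config_law. \<infinity> * indicator {0} (point_sum ?k z) \<noteq> (\<infinity> :: ennreal)"
    by (intro nn_integral_noteq_infinite) measurable
  then show ?thesis
  proof eventually_elim
    case (elim z)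
    then have "point_sum ?k z \<noteq> 0"
      by auto
    then obtain j where "?k (fst z j) * of_bool (active j z) \<noteq> 0"
      unfolding point_sum_def by (metis (no_types, lifting) suminf_zero suminf_cong)
    then have "h (fst z j) * of_bool (active j z) \<noteq> 0"
      by (auto split: split_indicator_asm)
    moreover have "h (fst z j) * of_bool (active j z) \<le> point_sum h z"
      using point_sum_omit[of h z j] by simp
    ultimately show ?case
      by (metis le_zero_eq not_gr_zero)
  qed
qed

end

section \<open>Laws of the driving sequences\<close>

context prob_space
begin

lemma distr_indep_elements:
  assumes "indep_elements N X N' X'"
  shows "distr M (N \<Otimes>\<^sub>M N') (\<lambda>\<omega>. (X \<omega>, X' \<omega>)) = distr M N X \<Otimes>\<^sub>M distr M N' X'"
proof (rule pair_measure_eqI[symmetric])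
  have X [measurable]: "X \<in> M \<rightarrow>\<^sub>M N" and X' [measurable]: "X' \<in> M \<rightarrow>\<^sub>M N'"
    and indep: "indep_set {X -` A \<inter> space M | A. A \<in> sets N} {X' -` A \<inter> space M | A. A \<in> sets N'}"
    using assms by (simp_all add: indep_elements_def)
  interpret D: prob_space "distr M N X" by (rule prob_space_distr) (rule X)
  interpret D': prob_space "distr M N' X'" by (rule prob_space_distr) (rule X')
  show "sigma_finite_measure (distr M N X)" "sigma_finite_measure (distr M N' X')" ..
  show "sets (distr M N X \<Otimes>\<^sub>M distr M N' X') = sets (distr M (N \<Otimes>\<^sub>M N') (\<lambda>\<omega>. (X \<omega>, X' \<omega>)))"
    by (simp cong: sets_pair_measure_cong)
  fix A B assume "A \<in> sets (distr M N X)" "B \<in> sets (distr M N' X')"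
  then have A [measurable]: "A \<in> sets N" and B [measurable]: "B \<in> sets N'"
    by simp_all
  have "emeasure (distr M (N \<Otimes>\<^sub>M N') (\<lambda>\<omega>. (X \<omega>, X' \<omega>))) (A \<times> B) =
      emeasure M ((X -` A \<inter> space M) \<inter> (X' -` B \<inter> space M))"
    by (subst emeasure_distr) (auto intro!: arg_cong[where f="emeasure M"])
  also have "\<dots> = emeasure M (X -` A \<inter> space M) * emeasure M (X' -` B \<inter> space M)"
  proof -
    have "prob ((X -` A \<inter> space M) \<inter> (X' -` B \<inter> space M)) = prob (X -` A \<inter> space M) * prob (X' -` B \<inter> space M)"
      using A B by (intro indep_setD[OF indep]) auto
    then show ?thesis
      by (simp add: emeasure_eq_measure ennreal_mult)
  qed
  finally show "emeasure (distr M N X) A * emeasure (distr M N' X') B =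
      emeasure (distr M (N \<Otimes>\<^sub>M N') (\<lambda>\<omega>. (X \<omega>, X' \<omega>))) (A \<times> B)"
    by (simp add: emeasure_distr)
qed

lemma distr_iid_sequence:
  assumes "iid_sequence N X D"
  shows "distr M (Pi\<^sub>M UNIV (\<lambda>_. N)) (\<lambda>\<omega> j. X j \<omega>) = Pi\<^sub>M UNIV (\<lambda>_. D)"
proof -
  have indep: "indep_vars (\<lambda>_. N) X UNIV" and D: "\<And>j. distr M N (X j) = D"
    using assms by (simp_all add: iid_sequence_def)
  have rv: "random_variable N (X j)" for j
    using indep by (simp add: indep_vars_def)
  show ?thesis
    using indep indep_vars_iff_distr_eq_PiM[where I=UNIV and M'="\<lambda>_. N" and X=X, OF _ rv] by (simp add: D restrict_UNIV)
qed

lemma distr_exponential_partial_sums: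
  assumes "exponential_partial_sums \<Gamma>"
  shows "distr M (Pi\<^sub>M UNIV (\<lambda>_. borel)) (\<lambda>\<omega> j. \<Gamma> j \<omega>) = arrival_law"
proof -
  obtain E where E: "iid_sequence borel E exp_law"
    and \<Gamma>: "\<And>j \<omega>. \<omega> \<in> space M \<Longrightarrow> \<Gamma> j \<omega> = (\<Sum>k\<le>j. E k \<omega>)"
    using assms by (auto simp: exponential_partial_sums_def)
  have "sets (Pi\<^sub>M UNIV (\<lambda>_::nat. exp_law)) = sets (Pi\<^sub>M UNIV (\<lambda>_. borel))"
    by (rule sets_PiM_cong) simp_all
  note sets_eq = measurable_cong_sets[OF refl this] measurable_cong_sets[OF this refl]
  have "random_variable borel (E j)" for j
    using E by (simp add: iid_sequence_def indep_vars_def)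
  then have rv: "random_variable (Pi\<^sub>M UNIV (\<lambda>_. borel)) (\<lambda>\<omega> j. E j \<omega>)"
    by (intro measurable_PiM_single') (auto simp: space_PiM)
  have "distr M (Pi\<^sub>M UNIV (\<lambda>_. borel)) (\<lambda>\<omega> j. \<Gamma> j \<omega>) =
      distr M (Pi\<^sub>M UNIV (\<lambda>_. borel)) (\<lambda>\<omega>. partial_sums (\<lambda>j. E j \<omega>))"
    by (rule distr_cong) (simp_all add: \<Gamma> partial_sums_def fun_eq_iff)
  also have "\<dots> = distr (distr M (Pi\<^sub>M UNIV (\<lambda>_. borel)) (\<lambda>\<omega> j. E j \<omega>)) (Pi\<^sub>M UNIV (\<lambda>_. borel)) partial_sums"
    using measurable_partial_sums
    by (subst distr_distr[OF _ rv]) (simp_all add: sets_eq comp_def)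
  also have "\<dots> = arrival_law"
    by (simp add: distr_iid_sequence[OF E] arrival_law_def)
  finally show ?thesis .
qed

end

section \<open>The change of measure by a translation\<close>

theorem theorem5p6:
  fixes \<nu> :: "('t \<Rightarrow> real) measure" and b :: "'t \<Rightarrow> real" and \<kappa> :: "real \<Rightarrow> real"
    and n :: "'s measure" and V :: "'t \<Rightarrow> 's \<Rightarrow> real" and g :: "'s \<Rightarrow> real"
    and M :: "'w measure" and \<xi> :: "nat \<Rightarrow> 'w \<Rightarrow> 's" and \<Gamma> :: "nat \<Rightarrow> 'w \<Rightarrow> real"
    and c :: "nat \<Rightarrow> 't \<Rightarrow> real" and Y :: "'t \<Rightarrow> 'w \<Rightarrow> real"
    and \<xi>0 :: "'w \<Rightarrow> 's" and q :: "'s \<Rightarrow> ennreal" and Q :: "'w \<Rightarrow> ennreal"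
  assumes levy: "levy_measure \<nu>"
    and cutoff: "cutoff_function \<kappa>"
    and sigma_finite: "sigma_finite_measure n"
    and repr: "levy_representation \<nu> n V"
    and g_meas: "g \<in> borel_measurable n"
    and g_pos: "AE s in n. g s > 0"
    and g_prob: "prob_space (density n (\<lambda>s. ennreal (g s)))"
    and M: "prob_space M"
    and \<xi>_iid: "prob_space.iid_sequence M n \<xi> (density n (\<lambda>s. ennreal (g s)))"
    and \<Gamma>_sums: "prob_space.exponential_partial_sums M \<Gamma>"
    and \<xi>_\<Gamma>_indep: "prob_space.indep_elements M (Pi\<^sub>M UNIV (\<lambda>_. n)) (\<lambda>\<omega> j. \<xi> j \<omega>)
           (Pi\<^sub>M UNIV (\<lambda>_. borel)) (\<lambda>\<omega> j. \<Gamma> j \<omega>)"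
    and c: "\<And>j t. c j t =
           (\<integral>s. V t s * \<kappa> (V t s) * (min (real (j + 1) * g s) 1 - min (real j * g s) 1) \<partial>n)"
    and Y_id: "prob_space.poissonian_id_process M \<nu> \<kappa> b Y"
    and Y_series: "\<And>t. AE \<omega> in M.
           (\<lambda>j. V t (\<xi> j \<omega>) * of_bool (g (\<xi> j \<omega>) \<le> inverse (\<Gamma> j \<omega>)) - c j t)
             sums (Y t \<omega> - b t)"
    and \<xi>0_indep: "prob_space.indep_elements M n \<xi>0
           (Pi\<^sub>M UNIV (\<lambda>_. n) \<Otimes>\<^sub>M Pi\<^sub>M UNIV (\<lambda>_. borel)) (\<lambda>\<omega>. (\<lambda>j. \<xi> j \<omega>, \<lambda>j. \<Gamma> j \<omega>))"
    and \<xi>0_ac: "absolutely_continuous (distr M n (\<xi> 0)) (distr M n \<xi>0)"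
    and q_meas: "q \<in> borel_measurable n"
    and q_density: "distr M n \<xi>0 = density n q"
    and Q: "\<And>\<omega>. Q \<omega> = (\<Sum>j. q (\<xi> j \<omega>) * of_bool (g (\<xi> j \<omega>) \<le> inverse (\<Gamma> j \<omega>)))"
  shows "(\<forall>F \<in> borel_measurable path_space. \<forall>e.
            has_ext_integral M (\<lambda>\<omega>. ereal (F (\<lambda>t. V t (\<xi>0 \<omega>) + Y t \<omega>))) e \<longleftrightarrow>
            has_ext_integral M (\<lambda>\<omega>. ereal (F (\<lambda>t. Y t \<omega>)) * enn2ereal (Q \<omega>)) e) \<and>
         (\<forall>F \<in> borel_measurable path_space. \<forall>e.
            has_ext_integral M (\<lambda>\<omega>. ereal (F (\<lambda>t. Y t \<omega>) * of_bool (Q \<omega> > 0))) e \<longleftrightarrow>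
            has_iterated_ext_integral M n
              (\<lambda>\<omega> s. ereal (F (\<lambda>t. V t s + Y t \<omega>)) * enn2ereal (inverse (Q \<omega> + q s) * q s)) e) \<and>
         (emeasure n {s \<in> space n. q s > 0} = \<infinity> \<longrightarrow> (AE \<omega> in M. Q \<omega> > 0))"
proof -
  interpret marked_arrivals n g
    using sigma_finite g_meas g_pos g_prob by (intro marked_arrivals.intro marked_arrivals_axioms.intro)
  interpret prob_space M by (rule M)
  interpret Mn: pair_sigma_finite M n ..
  interpret nM: pair_sigma_finite n M ..
  interpret C: prob_space config_law by (rule prob_space_config_law)
  let ?C = "Pi\<^sub>M UNIV (\<lambda>_::nat. n) \<Otimes>\<^sub>M Pi\<^sub>M UNIV (\<lambda>_::nat. borel :: real measure)"
  define R where "R \<omega> = (\<lambda>j. \<xi> j \<omega>, \<lambda>j. \<Gamma> j \<omega>)" for \<omega>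
  define S where "S = compensated_sum V (\<lambda>t j. c j t)"
  have V [measurable]: "V t \<in> borel_measurable n" for t
    using repr by (simp add: levy_representation_def)
  have Y [measurable]: "Y t \<in> borel_measurable M" for t
    using Y_id by (simp add: poissonian_id_process_def)
  have R [measurable]: "R \<in> M \<rightarrow>\<^sub>M ?C"
    using \<xi>_\<Gamma>_indep unfolding R_def[abs_def] indep_elements_def by (intro measurable_Pair) auto
  have \<xi>0 [measurable]: "\<xi>0 \<in> M \<rightarrow>\<^sub>M n"
    using \<xi>0_indep by (simp add: indep_elements_def)
  note [measurable] = q_meas
  have S: "S \<in> ?C \<rightarrow>\<^sub>M path_space"
    unfolding S_def by (rule measurable_compensated_sum) (rule V)
  have S_at [measurable]: "(\<lambda>z. S z t) \<in> borel_measurable ?C" for t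
    by (rule measurable_compose[OF S measurable_coordinate])
  have R_law: "distr M ?C R = config_law"
    unfolding R_def[abs_def] distr_indep_elements[OF \<xi>_\<Gamma>_indep] config_law_def mark_law_def
      distr_iid_sequence[OF \<xi>_iid] distr_exponential_partial_sums[OF \<Gamma>_sums] ..
  have joint_law: "distr M (n \<Otimes>\<^sub>M ?C) (\<lambda>\<omega>. (\<xi>0 \<omega>, R \<omega>)) = density n q \<Otimes>\<^sub>M config_law"
    using distr_indep_elements[OF \<xi>0_indep] by (simp add: q_density R_law flip: R_def)
  have Q_R: "Q \<omega> = point_sum q (R \<omega>)" for \<omega>
    by (simp add: Q point_sum_def active_def R_def)
  have Q_meas [measurable]: "Q \<in> borel_measurable M"
  proof -
    have "(\<lambda>\<omega>. point_sum q (R \<omega>)) \<in> borel_measurable M"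
      by measurable
    then show ?thesis
      by (simp add: Q_R[abs_def])
  qed
  have Y_S: "AE \<omega> in M. Y t \<omega> = b t + S (R \<omega>) t" for t
    using Y_series[of t] by eventually_elim (simp add: S_def compensated_sum_def active_def R_def sums_iff)
  have c_lim: "(\<lambda>j. c j t) \<longlonglongrightarrow> 0" for t
    using compensator_tendsto_0[OF cutoff V[of t]] by (simp add: c)
  have conv: "AE z in config_law. summable (\<lambda>j. V t (fst z j) * of_bool (active j z) - c j t)" for t
  proof -
    have "{z \<in> space ?C. summable (\<lambda>j. V t (fst z j) * of_bool (active j z) - c j t)} \<in> sets ?C"
      unfolding summable_iff_convergent Cauchy_convergent_iff[symmetric] by measurable
    moreover have "AE \<omega> in M. summable (\<lambda>j. V t (fst (R \<omega>) j) * of_bool (active j (R \<omega>)) - c j t)"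
      using Y_series[of t] by eventually_elim (auto simp: active_def R_def sums_iff)
    ultimately show ?thesis
      unfolding R_law[symmetric] by (subst AE_distr_iff[OF R])
  qed

  \<comment> \<open>Mecke's formula for \<open>Y\<close> and \<open>Q\<close> themselves, and a variant whose right-hand side lives on sequences,
      where the joint law with \<open>\<xi>0\<close> is known.\<close>
  have Mecke: "(\<integral>\<^sup>+\<omega>. F (\<lambda>t. Y t \<omega>) * \<phi> (Q \<omega>) * Q \<omega> \<partial>M) =
      (\<integral>\<^sup>+\<omega>. \<integral>\<^sup>+s. F (\<lambda>t. V t s + Y t \<omega>) * \<phi> (Q \<omega> + q s) * q s \<partial>n \<partial>M)" (is "?lhs = ?rhs")
    and Mecke': "(\<integral>\<^sup>+\<omega>. F (\<lambda>t. Y t \<omega>) * \<phi> (Q \<omega>) * Q \<omega> \<partial>M) =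
      (\<integral>\<^sup>+z. \<integral>\<^sup>+s. F (\<lambda>t. b t + (V t s + S z t)) * \<phi> (point_sum q z + q s) * q s \<partial>n \<partial>config_law)" (is "_ = ?mid")
    if F [measurable]: "F \<in> borel_measurable path_space" and \<phi> [measurable]: "\<phi> \<in> borel_measurable borel"
    for F :: "('t \<Rightarrow> real) \<Rightarrow> ennreal" and \<phi> :: "ennreal \<Rightarrow> ennreal"
  proof -
    define F' where "F' x = F (\<lambda>t. b t + x t)" for x
    have F' [measurable]: "F' \<in> borel_measurable path_space"
      unfolding F'_def[abs_def]
      by (rule measurable_path_functional[OF F], rule borel_measurable_add[OF borel_measurable_const])
        (rule measurable_coordinate)
    have SR: "(\<lambda>\<omega>. S (R \<omega>) t) \<in> borel_measurable M" for t
      by measurable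
    note [measurable] = SR
    have [measurable]: "(\<lambda>z. F' (S z)) \<in> borel_measurable ?C"
      by (rule measurable_path_functional[OF F']) (rule S_at)
    have [measurable]: "(\<lambda>(z, s). F (\<lambda>t. b t + (V t s + S z t))) \<in> borel_measurable (?C \<Otimes>\<^sub>M n)"
      unfolding case_prod_beta' by (rule measurable_path_functional[OF F]) measurable
    have [measurable]: "(\<lambda>(\<omega>, s). F (\<lambda>t. b t + (V t s + S (R \<omega>) t))) \<in> borel_measurable (M \<Otimes>\<^sub>M n)"
      "(\<lambda>(\<omega>, s). F (\<lambda>t. V t s + Y t \<omega>)) \<in> borel_measurable (M \<Otimes>\<^sub>M n)"
      unfolding case_prod_beta' by (rule measurable_path_functional[OF F]; measurable)+
    have "AE \<omega> in M. F (\<lambda>t. Y t \<omega>) = F' (S (R \<omega>))"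
      unfolding F'_def by (rule AE_path_functional_eq[OF F]) (rule Y_S)
    then have "?lhs = (\<integral>\<^sup>+\<omega>. F' (S (R \<omega>)) * \<phi> (point_sum q (R \<omega>)) * point_sum q (R \<omega>) \<partial>M)"
      by (intro nn_integral_cong_AE) (auto elim!: eventually_mono simp: Q_R)
    also have "\<dots> = (\<integral>\<^sup>+z. F' (S z) * \<phi> (point_sum q z) * point_sum q z \<partial>config_law)"
      unfolding R_law[symmetric] by (rule nn_integral_distr[symmetric]) measurable
    also have "\<dots> = (\<integral>\<^sup>+z. \<integral>\<^sup>+s. F' (\<lambda>t. V t s + S z t) * \<phi> (point_sum q z + q s) * q s \<partial>n \<partial>config_law)"
      unfolding S_def by (rule Mecke_functional[OF V c_lim conv F' \<phi> q_meas])
    finally show mid: "?lhs = ?mid"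
      by (simp add: F'_def)
    \<comment> \<open>Replacing \<open>b + S\<close> by \<open>Y\<close> under the integral over \<open>s\<close> is possible for each \<open>s\<close> separately, since the
      exceptional set depends on \<open>s\<close>; hence the change of order.\<close>
    also have "?mid = (\<integral>\<^sup>+\<omega>. \<integral>\<^sup>+s. F (\<lambda>t. b t + (V t s + S (R \<omega>) t)) * \<phi> (Q \<omega> + q s) * q s \<partial>n \<partial>M)"
      unfolding R_law[symmetric] Q_R by (rule nn_integral_distr) measurable
    also have "\<dots> = (\<integral>\<^sup>+s. \<integral>\<^sup>+\<omega>. F (\<lambda>t. b t + (V t s + S (R \<omega>) t)) * \<phi> (Q \<omega> + q s) * q s \<partial>M \<partial>n)"
      by (rule nM.Fubini') measurable
    also have "\<dots> = (\<integral>\<^sup>+s. \<integral>\<^sup>+\<omega>. F (\<lambda>t. V t s + Y t \<omega>) * \<phi> (Q \<omega> + q s) * q s \<partial>M \<partial>n)"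
    proof (rule nn_integral_cong, rule nn_integral_cong_AE)
      fix s
      have "AE \<omega> in M. F (\<lambda>t. b t + (V t s + S (R \<omega>) t)) = F (\<lambda>t. V t s + Y t \<omega>)"
      proof (rule AE_path_functional_eq[OF F])
        show "AE \<omega> in M. b t + (V t s + S (R \<omega>) t) = V t s + Y t \<omega>" for t
          using Y_S[of t] by eventually_elim simp
      qed
      then show "AE \<omega> in M. F (\<lambda>t. b t + (V t s + S (R \<omega>) t)) * \<phi> (Q \<omega> + q s) * q s =
          F (\<lambda>t. V t s + Y t \<omega>) * \<phi> (Q \<omega> + q s) * q s"
        by eventually_elim simp
    qed
    also have "\<dots> = ?rhs"
      by (rule nM.Fubini'[symmetric]) measurable
    finally show "?lhs = ?rhs" .
  qed

  have mass_q: "(\<integral>\<^sup>+s. q s \<partial>n) = 1"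
  proof -
    have "emeasure (density n q) (space n) = 1"
      using prob_space.emeasure_space_1[OF prob_space_distr[OF \<xi>0]] by (simp add: q_density)
    then show ?thesis
      by (simp add: emeasure_density cong: nn_integral_cong)
  qed
  have Q_finite: "AE \<omega> in M. Q \<omega> \<noteq> \<infinity>"
  proof (rule nn_integral_noteq_infinite[OF Q_meas])
    have "(\<integral>\<^sup>+\<omega>. 1 * 1 * Q \<omega> \<partial>M) = (\<integral>\<^sup>+\<omega>. \<integral>\<^sup>+s. 1 * 1 * q s \<partial>n \<partial>M)"
      by (rule Mecke) (rule borel_measurable_const)+
    then show "(\<integral>\<^sup>+\<omega>. Q \<omega> \<partial>M) \<noteq> \<infinity>"
      by (simp only: mult_1 mass_q nn_integral_const emeasure_space_1) simp
  qed

  have shifted: "(\<integral>\<^sup>+\<omega>. F (\<lambda>t. V t (\<xi>0 \<omega>) + Y t \<omega>) \<partial>M) = (\<integral>\<^sup>+\<omega>. F (\<lambda>t. Y t \<omega>) * Q \<omega> \<partial>M)"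
    if F [measurable]: "F \<in> borel_measurable path_space" for F :: "('t \<Rightarrow> real) \<Rightarrow> ennreal"
  proof -
    have [measurable]: "(\<lambda>(s, z). F (\<lambda>t. b t + (V t s + S z t))) \<in> borel_measurable (n \<Otimes>\<^sub>M ?C)"
      unfolding case_prod_beta' by (rule measurable_path_functional[OF F]) measurable
    interpret D: prob_space "density n q"
      using prob_space_distr[OF \<xi>0] by (simp add: q_density)
    interpret DC: pair_sigma_finite "density n q" config_law ..
    have "AE \<omega> in M. F (\<lambda>t. V t (\<xi>0 \<omega>) + Y t \<omega>) = F (\<lambda>t. b t + (V t (\<xi>0 \<omega>) + S (R \<omega>) t))"
    proof (rule AE_path_functional_eq[OF F])
      show "AE \<omega> in M. V t (\<xi>0 \<omega>) + Y t \<omega> = b t + (V t (\<xi>0 \<omega>) + S (R \<omega>) t)" for t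
        using Y_S[of t] by eventually_elim simp
    qed
    then have "(\<integral>\<^sup>+\<omega>. F (\<lambda>t. V t (\<xi>0 \<omega>) + Y t \<omega>) \<partial>M) =
        (\<integral>\<^sup>+\<omega>. (case (\<xi>0 \<omega>, R \<omega>) of (s, z) \<Rightarrow> F (\<lambda>t. b t + (V t s + S z t))) \<partial>M)"
      by (intro nn_integral_cong_AE) simp
    also have "\<dots> = (\<integral>\<^sup>+p. (case p of (s, z) \<Rightarrow> F (\<lambda>t. b t + (V t s + S z t))) \<partial>(density n q \<Otimes>\<^sub>M config_law))"
      unfolding joint_law[symmetric] by (rule nn_integral_distr[symmetric]) measurable
    also have "\<dots> = (\<integral>\<^sup>+z. \<integral>\<^sup>+s. F (\<lambda>t. b t + (V t s + S z t)) \<partial>density n q \<partial>config_law)"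
      by (subst DC.nn_integral_snd[symmetric]) simp_all
    also have "\<dots> = (\<integral>\<^sup>+z. \<integral>\<^sup>+s. F (\<lambda>t. b t + (V t s + S z t)) * q s \<partial>n \<partial>config_law)"
    proof (rule nn_integral_cong)
      fix z assume "z \<in> space config_law"
      then have [measurable]: "z \<in> space ?C"
        using sets_eq_imp_space_eq[OF sets_config_law] by simp
      show "(\<integral>\<^sup>+s. F (\<lambda>t. b t + (V t s + S z t)) \<partial>density n q) = (\<integral>\<^sup>+s. F (\<lambda>t. b t + (V t s + S z t)) * q s \<partial>n)"
        by (subst nn_integral_density) (simp_all add: mult.commute)
    qed
    also have "\<dots> = (\<integral>\<^sup>+\<omega>. F (\<lambda>t. Y t \<omega>) * Q \<omega> \<partial>M)"
      using Mecke'[OF F, of "\<lambda>_. 1"] by simp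
    finally show ?thesis .
  qed

  have inverted: "(\<integral>\<^sup>+\<omega>. F (\<lambda>t. Y t \<omega>) * of_bool (0 < Q \<omega>) \<partial>M) =
      (\<integral>\<^sup>+\<omega>. \<integral>\<^sup>+s. F (\<lambda>t. V t s + Y t \<omega>) * (inverse (Q \<omega> + q s) * q s) \<partial>n \<partial>M)"
    if F [measurable]: "F \<in> borel_measurable path_space" for F :: "('t \<Rightarrow> real) \<Rightarrow> ennreal"
  proof -
    have "AE \<omega> in M. inverse (Q \<omega>) * Q \<omega> = of_bool (0 < Q \<omega>)"
      using Q_finite
    proof eventually_elim
      case (elim \<omega>)
      then show ?case
        by (cases "Q \<omega>") (auto simp: inverse_ennreal zero_less_iff_neq_zero simp flip: ennreal_mult)
    qed
    then have "(\<integral>\<^sup>+\<omega>. F (\<lambda>t. Y t \<omega>) * of_bool (0 < Q \<omega>) \<partial>M) = (\<integral>\<^sup>+\<omega>. F (\<lambda>t. Y t \<omega>) * inverse (Q \<omega>) * Q \<omega> \<partial>M)"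
      by (intro nn_integral_cong_AE) (auto elim!: eventually_mono simp: mult.assoc)
    then show ?thesis
      using Mecke[OF F, of inverse] by (simp add: mult.assoc)
  qed

  have YM: "(\<lambda>\<omega>. F (\<lambda>t. Y t \<omega>)) \<in> borel_measurable M" "(\<lambda>\<omega>. F (\<lambda>t. V t (\<xi>0 \<omega>) + Y t \<omega>)) \<in> borel_measurable M"
    "(\<lambda>(\<omega>, s). F (\<lambda>t. V t s + Y t \<omega>)) \<in> borel_measurable (M \<Otimes>\<^sub>M n)"
    if F: "F \<in> borel_measurable path_space" for F :: "('t \<Rightarrow> real) \<Rightarrow> real"
    unfolding case_prod_beta' by (rule measurable_path_functional[OF F]; measurable)+
  show ?thesis
  proof (intro conjI ballI allI impI)
    fix F :: "('t \<Rightarrow> real) \<Rightarrow> real" and e assume F [measurable]: "F \<in> borel_measurable path_space"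
    note [measurable] = YM[OF F]
    show "has_ext_integral M (\<lambda>\<omega>. ereal (F (\<lambda>t. V t (\<xi>0 \<omega>) + Y t \<omega>))) e \<longleftrightarrow>
        has_ext_integral M (\<lambda>\<omega>. ereal (F (\<lambda>t. Y t \<omega>)) * enn2ereal (Q \<omega>)) e"
      using shifted[of "\<lambda>x. ennreal (F x)"] shifted[of "\<lambda>x. ennreal (- F x)"]
      by (intro has_ext_integral_iff_eq_parts) (simp_all add: e2ennreal_ereal_times_enn2ereal)
    have "has_ext_integral M (\<lambda>\<omega>. ereal (F (\<lambda>t. Y t \<omega>) * of_bool (0 < Q \<omega>))) e \<longleftrightarrow>
        has_ext_integral (M \<Otimes>\<^sub>M n) (\<lambda>(\<omega>, s). ereal (F (\<lambda>t. V t s + Y t \<omega>)) * enn2ereal (inverse (Q \<omega> + q s) * q s)) e"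
    proof (rule has_ext_integral_iff_eq_parts)
      \<comment> \<open>In this form the positive and negative parts on both sides are computed by one rule.\<close>
      have *: "ereal (F (\<lambda>t. Y t \<omega>) * of_bool (0 < Q \<omega>)) = ereal (F (\<lambda>t. Y t \<omega>)) * enn2ereal (of_bool (0 < Q \<omega>))" for \<omega>
        by (cases "0 < Q \<omega>") (simp_all add: zero_ennreal.rep_eq one_ennreal.rep_eq flip: zero_ereal_def)
      show "(\<integral>\<^sup>+\<omega>. e2ennreal (ereal (F (\<lambda>t. Y t \<omega>) * of_bool (0 < Q \<omega>))) \<partial>M) =
          (\<integral>\<^sup>+p. e2ennreal (case p of (\<omega>, s) \<Rightarrow> ereal (F (\<lambda>t. V t s + Y t \<omega>)) * enn2ereal (inverse (Q \<omega> + q s) * q s)) \<partial>(M \<Otimes>\<^sub>M n))"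
        unfolding * using inverted[of "\<lambda>x. ennreal (F x)"]
        by (subst sigma_finite_measure.nn_integral_fst[OF \<open>sigma_finite_measure n\<close>, symmetric]) (simp_all add: e2ennreal_ereal_times_enn2ereal)
      show "(\<integral>\<^sup>+\<omega>. e2ennreal (- ereal (F (\<lambda>t. Y t \<omega>) * of_bool (0 < Q \<omega>))) \<partial>M) =
          (\<integral>\<^sup>+p. e2ennreal (- (case p of (\<omega>, s) \<Rightarrow> ereal (F (\<lambda>t. V t s + Y t \<omega>)) * enn2ereal (inverse (Q \<omega> + q s) * q s))) \<partial>(M \<Otimes>\<^sub>M n))"
        unfolding * using inverted[of "\<lambda>x. ennreal (- F x)"]
        by (subst sigma_finite_measure.nn_integral_fst[OF \<open>sigma_finite_measure n\<close>, symmetric]) (simp_all add: e2ennreal_ereal_times_enn2ereal)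
    qed measurable
    also have "\<dots> \<longleftrightarrow> has_iterated_ext_integral M n
        (\<lambda>\<omega> s. ereal (F (\<lambda>t. V t s + Y t \<omega>)) * enn2ereal (inverse (Q \<omega> + q s) * q s)) e"
      by (rule Mn.has_iterated_ext_integral_iff[symmetric]) measurable
    finally show "has_ext_integral M (\<lambda>\<omega>. ereal (F (\<lambda>t. Y t \<omega>) * of_bool (0 < Q \<omega>))) e \<longleftrightarrow> \<dots>" .
  next
    assume "emeasure n {s \<in> space n. 0 < q s} = \<infinity>"
    then have "AE z in distr M ?C R. 0 < point_sum q z"
      unfolding R_law by (rule AE_point_sum_pos[OF q_meas])
    then show "AE \<omega> in M. 0 < Q \<omega>"
      unfolding Q_R by (rule AE_distrD[OF R])
  qed
qed

end
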